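(* Let $G$ be a regular simple graph on $n$ vertices. If $G = rK_{n/r}$ (the disjoint union of $r$ copies of the complete graph on $n/r$ vertices) with $r\neq n$, or $G$ is the complement of such a graph, then $\mathrm{Rep}(G) = n-r$. Otherwise, let $\tau_1<\dots<\tau_s$ be the distinct eigenvalues of the adjacency matrix of $G$, with multiplicities $m_1,\dots,m_s$; so $m_1$ and $m_{s-1}$ are the multiplicities of the smallest and second largest distinct eigenvalues. If $G$ is connected, then $\mathrm{Rep}(G) = n-1-\max\{m_1,m_{s-1}\}$. If $G$ is disconnected with $r$ components, then $\mathrm{Rep}(G) = n-1-\max\{m_1,r-1\}$.
   Context: A simple graph $G$ is representable in $\mathbb{R}^m$ if there is a map from its vertex set into $\mathbb{R}^m$ and distinct positive constants $\alpha\neq\beta$ such that for all distinct vertices $u,v$, the Euclidean distance between their images is $\alpha$ if $u\sim v$ and $\beta$ otherwise; $\mathrm{Rep}(G)$ is the smallest such $m$. *)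

theory Defs
  imports
    "HOL-Analysis.Analysis"
    "Graph_Theory.Digraph_Isomorphism"
begin

text \<open>
  Finite simple graphs are the \<^locale>\<open>pair_graph\<close>s of the library: an undirected edge
  \<open>uv\<close> is present as the two arcs \<open>(u, v)\<close> and \<open>(v, u)\<close>.
\<close>

definition regular_graph :: "'a pair_pre_digraph \<Rightarrow> bool" where
  "regular_graph G \<longleftrightarrow> (\<exists>k. \<forall>v\<in>pverts G. out_degree (with_proj G) v = k)"

definition graph_complement :: "'a pair_pre_digraph \<Rightarrow> 'a pair_pre_digraph" where
  "graph_complement G =
    \<lparr>pverts = pverts G,
     parcs = {(u, v). u \<in> pverts G \<and> v \<in> pverts G \<and> u \<noteq> v \<and> (u, v) \<notin> parcs G}\<rparr>"

text \<open>The disjoint union of \<open>r\<close> copies of the complete graph on \<open>q\<close> vertices; the vertex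
  \<open>(i, a)\<close> is the vertex \<open>a\<close> of the copy \<open>i\<close>.\<close>

definition copies_of_complete :: "nat \<Rightarrow> nat \<Rightarrow> (nat \<times> nat) pair_pre_digraph" where
  "copies_of_complete r q =
    \<lparr>pverts = {..<r} \<times> {..<q},
     parcs = {((i, a), (j, b)). i < r \<and> j < r \<and> a < q \<and> b < q \<and> i = j \<and> a \<noteq> b}\<rparr>"

text \<open>When \<open>r\<close> does not divide the number of vertices, the graph on the right-hand sides has the
  wrong number of vertices, so no divisibility assumption is needed.\<close>

definition is_copies_or_complement :: "'a pair_pre_digraph \<Rightarrow> nat \<Rightarrow> bool" where
  "is_copies_or_complement G r \<longleftrightarrow>
    (let H = copies_of_complete r (card (pverts G) div r) in
      digraph_iso (with_proj G) (with_proj H) \<or>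
      digraph_iso (with_proj G) (with_proj (graph_complement H)))"

text \<open>The dimension \<open>m\<close> has to vary, so a point of \<open>\<real>\<^sup>m\<close> is a function on \<^typ>\<open>nat\<close> of
  which only the values at \<open>0, \<dots>, m - 1\<close> are used.\<close>

definition representable :: "'a pair_pre_digraph \<Rightarrow> nat \<Rightarrow> bool" where
  "representable G m \<longleftrightarrow>
    (\<exists>(f :: 'a \<Rightarrow> nat \<Rightarrow> real) \<alpha> \<beta>. 0 < \<alpha> \<and> 0 < \<beta> \<and> \<alpha> \<noteq> \<beta> \<and>
      (\<forall>u\<in>pverts G. \<forall>v\<in>pverts G. u \<noteq> v \<longrightarrow>
        L2_set (\<lambda>i. f u i - f v i) {..<m} = (if (u, v) \<in> parcs G then \<alpha> else \<beta>)))"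

definition Rep :: "'a pair_pre_digraph \<Rightarrow> nat" where
  "Rep G = (LEAST m. representable G m)"

definition adjacency_matrix :: "'v::finite pair_pre_digraph \<Rightarrow> real ^ 'v ^ 'v" where
  "adjacency_matrix G = (\<chi> u v. if (u, v) \<in> parcs G then 1 else 0)"

definition eigenspace :: "real ^ 'v ^ 'v \<Rightarrow> real \<Rightarrow> (real ^ 'v::finite) set" where
  "eigenspace A \<tau> = {x. A *v x = \<tau> *\<^sub>R x}"

definition eigenvalues :: "real ^ 'v ^ 'v::finite \<Rightarrow> real set" where
  "eigenvalues A = {\<tau>. \<exists>x. x \<noteq> 0 \<and> A *v x = \<tau> *\<^sub>R x}"

text \<open>Geometric multiplicity; for the symmetric matrices considered here it agrees with the
  algebraic one.\<close>

definition eigenvalue_multiplicity :: "real ^ 'v ^ 'v::finite \<Rightarrow> real \<Rightarrow> nat" where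
  "eigenvalue_multiplicity A \<tau> = dim (eigenspace A \<tau>)"

end

theory Submission
  imports Defs
begin

text \<open>
  By Schoenberg's criterion, squared distances \<open>a\<close> (adjacent) and \<open>b\<close> (non-adjacent) are realizable
  in \<open>\<real>\<^sup>m\<close> iff \<open>(b - a) A + b I\<close> is positive semidefinite of rank at most \<open>m\<close> on the hyperplane
  \<open>W\<close> orthogonal to the all-ones vector, which \<open>A\<close> preserves since the graph is regular. A non-trivial
  kernel is then an eigenspace of \<open>A\<close> on \<open>W\<close> for the eigenvalue \<open>b / (a - b)\<close>, which has to be the
  smallest one if \<open>a < b\<close> and the largest one if \<open>b < a\<close>. Every number less than \<open>-1\<close> or greater
  than \<open>0\<close> is of the form \<open>b / (a - b)\<close>, and the smallest eigenvalue on \<open>W\<close> is at least \<open>-1\<close> (the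
  largest one at most \<open>0\<close>) only if adjacency (non-adjacency) is transitive.
\<close>

section \<open>Positive semidefinite maps on a subspace\<close>

text \<open>The rank on W is n - 1 minus the dimension of the kernel, so the least m comes from the
  largest kernel, and only the ratio of a to b matters. This kernel lies inside W, while the theorem
  counts multiplicities on the whole space. The two counts differ only for the degree k, whose
  eigenspace contains the all-ones vector. Hence the case distinction: for r > 1 components k
  survives on W with dimension r - 1 and is the largest eigenvalue there, whereas for a connected
  graph it disappears from W and the second largest eigenvalue takes over. In the exceptional graphs
  one side is out of reach. For r disjoint cliques of size q >= 2 the only possible eigenvalues on W
  are -1 and q - 1; the value -1 is not b / (a - b) for any positive a and b, so only q - 1 is left,
  with an eigenspace of dimension r - 1 in W. Complements need no second computation, because
  exchanging the two distances represents the complement. The empty graph is exceptional through r =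
  1, as the complement of a complete graph.\<close>

definition self_adjoint_on :: "'a::euclidean_space set \<Rightarrow> ('a \<Rightarrow> 'a) \<Rightarrow> bool" where
  "self_adjoint_on S f \<longleftrightarrow>
    linear f \<and> (\<forall>x\<in>S. f x \<in> S) \<and> (\<forall>x\<in>S. \<forall>y\<in>S. f x \<bullet> y = x \<bullet> f y)"

definition psd_on :: "'a::euclidean_space set \<Rightarrow> ('a \<Rightarrow> 'a) \<Rightarrow> bool" where
  "psd_on S f \<longleftrightarrow> self_adjoint_on S f \<and> (\<forall>x\<in>S. 0 \<le> x \<bullet> f x)"

lemma subspace_kernel_on:
  assumes "subspace S" "linear f"
  shows "subspace {x \<in> S. f x = 0}"
  using assms by (auto simp: subspace_def linear_add linear_scale linear_0)

lemma self_adjoint_on_affine: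
  assumes "subspace S" "self_adjoint_on S f"
  shows "self_adjoint_on S (\<lambda>x. c *\<^sub>R f x + d *\<^sub>R x)"
  using assms unfolding self_adjoint_on_def
  by (auto intro!: linear_compose_add linear_compose_scale_right linear_id[unfolded id_def]
      simp: subspace_add subspace_scale inner_add_left inner_add_right)

text \<open>A null vector minimises the form on \<open>S\<close>. A step from \<open>x\<close> along
  \<open>- f x\<close> changes the form to first order by a negative multiple of the squared norm of
  \<open>f x\<close>, so a short step would make it negative.\<close>

lemma psd_on_null_vector:
  assumes S: "subspace S" and psd: "psd_on S f" and x: "x \<in> S" "x \<bullet> f x = 0"
  shows "f x = 0"
proof (rule ccontr)
  assume "f x \<noteq> 0"
  define y where "y = f x"
  define q where "q = y \<bullet> f y"
  define p where "p = y \<bullet> y"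
  have lin: "linear f" and yS: "y \<in> S" and adj: "f y \<bullet> x = p"
    using psd x(1) unfolding psd_on_def self_adjoint_on_def y_def p_def by auto
  have q: "q \<ge> 0"
    using psd yS by (simp add: psd_on_def q_def)
  have p: "p > 0"
    using \<open>f x \<noteq> 0\<close> by (simp add: p_def y_def)
  \<comment> \<open>Small enough that \<open>t * q\<close> is at most \<open>p\<close>; the summand
    1 covers \<open>q = 0\<close>.\<close>
  define t where "t = p / (q + 1)"
  have t: "t > 0"
    using p q by (simp add: t_def)
  have "x - t *\<^sub>R y \<in> S"
    using S x(1) yS by (simp add: subspace_diff subspace_scale)
  then have "0 \<le> (x - t *\<^sub>R y) \<bullet> f (x - t *\<^sub>R y)"
    using psd by (simp add: psd_on_def)
  also have "\<dots> = t * (t * q - 2 * p)"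
    using x(2) adj
    by (simp add: linear_diff[OF lin] linear_scale[OF lin] inner_diff_left inner_diff_right
        inner_commute y_def[symmetric] p_def[symmetric] q_def[symmetric] algebra_simps)
  finally have "2 * p \<le> t * q"
    using t by (simp add: zero_le_mult_iff)
  moreover have "t * q \<le> p"
    using p q by (simp add: t_def field_simps)
  ultimately show False
    using p by simp
qed

text \<open>Lagrange's reduction: subtracting the square of one linear form enlarges the kernel.\<close>

lemma psd_on_sum_of_squares:
  fixes f :: "'a::euclidean_space \<Rightarrow> 'a"
  assumes "subspace S" "psd_on S f" "dim S \<le> m + dim {x \<in> S. f x = 0}"
  shows "\<exists>w :: nat \<Rightarrow> 'a. \<forall>x\<in>S. x \<bullet> f x = (\<Sum>i<m. (w i \<bullet> x)\<^sup>2)"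
  using assms(2,3)
proof (induction m arbitrary: f)
  case 0
  then have "linear f"
    by (simp add: psd_on_def self_adjoint_on_def)
  then have "{x \<in> S. f x = 0} = S"
    using 0 assms(1) by (intro subspace_dim_equal subspace_kernel_on) auto
  then have "\<forall>x\<in>S. f x = 0" by blast
  then show ?case by simp
next
  case (Suc m)
  have lin: "linear f" and fS: "\<And>x. x \<in> S \<Longrightarrow> f x \<in> S"
    and adj: "\<And>x y. x \<in> S \<Longrightarrow> y \<in> S \<Longrightarrow> f x \<bullet> y = x \<bullet> f y"
    and nonneg: "\<And>x. x \<in> S \<Longrightarrow> 0 \<le> x \<bullet> f x"
    using Suc.prems(1) by (auto simp: psd_on_def self_adjoint_on_def)
  show ?case
  proof (cases "\<forall>x\<in>S. f x = 0")
    case True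
    then show ?thesis by (intro exI[of _ "\<lambda>_. 0"]) auto
  next
    case False
    then obtain x where x: "x \<in> S" "f x \<noteq> 0" by blast
    define p where "p = x \<bullet> f x"
    have p: "p > 0"
      using psd_on_null_vector[OF assms(1) Suc.prems(1) x(1)] x(2) nonneg[OF x(1)]
      by (force simp: p_def)
    \<comment> \<open>The square of the linear form given by \<open>f x\<close>, scaled by
      \<open>1 / p\<close>, is split off. The kernel of \<open>g\<close> keeps that of
      \<open>f\<close> and gains \<open>x\<close>.\<close>
    define g where "g y = f y - ((y \<bullet> f x) / p) *\<^sub>R f x" for y
    have form: "y \<bullet> g y = y \<bullet> f y - (y \<bullet> f x)\<^sup>2 / p" for y
      by (simp add: g_def inner_diff_right power2_eq_square)
    have psd_g: "psd_on S g"
      unfolding psd_on_def self_adjoint_on_def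
    proof (intro conjI ballI)
      show "linear g"
        unfolding g_def
        by (rule linearI)
          (simp_all add: linear_add[OF lin] linear_scale[OF lin] inner_add_left
            add_divide_distrib scaleR_add_left scaleR_add_right scaleR_diff_right)
      fix y assume y: "y \<in> S"
      then show "g y \<in> S"
        using assms(1) fS x(1) by (simp add: g_def subspace_diff subspace_scale)
      show "g y \<bullet> z = y \<bullet> g z" if "z \<in> S" for z
        using adj[OF y that] by (simp add: g_def inner_diff_left inner_diff_right inner_commute)
      \<comment> \<open>This is \<open>y\<close> without its component along \<open>x\<close> with
        respect to the form; its \<open>f\<close>-value is the \<open>g\<close>-value of
        \<open>y\<close>.\<close>
      have "y - ((y \<bullet> f x) / p) *\<^sub>R x \<in> S"
        using assms(1) y x(1) by (simp add: subspace_diff subspace_scale)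
      from nonneg[OF this] have "0 \<le> y \<bullet> f y - (y \<bullet> f x)\<^sup>2 / p"
        using adj[OF y x(1)] p
        by (simp add: linear_diff[OF lin] linear_scale[OF lin] inner_diff_left inner_diff_right
            inner_commute p_def[symmetric] power2_eq_square)
      then show "0 \<le> y \<bullet> g y"
        by (simp add: form)
    qed
    then have lin_g: "linear g"
      by (simp add: psd_on_def self_adjoint_on_def)
    have "g x = 0"
      using p by (simp add: g_def p_def)
    moreover have "g y = 0" if "y \<in> S" "f y = 0" for y
      using adj[OF that(1) x(1)] that(2) by (simp add: g_def)
    ultimately have "{y \<in> S. f y = 0} \<subset> {y \<in> S. g y = 0}"
      using x by blast
    then have "dim {y \<in> S. f y = 0} < dim {y \<in> S. g y = 0}"
      using subspace_kernel_on[OF assms(1) lin] subspace_kernel_on[OF assms(1) lin_g]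
      by (intro dim_psubset) (simp add: span_eq_iff[THEN iffD2])
    then have "dim S \<le> m + dim {y \<in> S. g y = 0}"
      using Suc.prems(2) by linarith
    from Suc.IH[OF psd_g this] obtain w :: "nat \<Rightarrow> 'a"
      where w: "\<forall>y\<in>S. y \<bullet> g y = (\<Sum>i<m. (w i \<bullet> y)\<^sup>2)" by blast
    define w' where "w' = w(m := (1 / sqrt p) *\<^sub>R f x)"
    have "y \<bullet> f y = (\<Sum>i<Suc m. (w' i \<bullet> y)\<^sup>2)" if "y \<in> S" for y
      using bspec[OF w that] form[of y] p
      by (simp add: w'_def power_mult_distrib power_divide inner_commute)
    then show ?thesis by blast
  qed
qed

text \<open>The common zeros are the intersection of \<open>S\<close> with the orthogonal complement
  of the span of the \<open>w i\<close>, which has codimension at most \<open>m\<close>; the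
  dimension formula for sums of subspaces does the rest. It bounds the rank of a form that comes
  from \<open>m\<close> coordinates.\<close>

lemma dim_le_common_zeros:
  fixes w :: "nat \<Rightarrow> 'a::euclidean_space"
  assumes "subspace S"
  shows "dim S \<le> m + dim {x \<in> S. \<forall>i<m. w i \<bullet> x = 0}"
proof -
  define U where "U = span (w ` {..<m})"
  define T where "T = {x. \<forall>u\<in>U. orthogonal u x}"
  have "dim T + dim U = DIM('a)"
    using dim_subspace_orthogonal_to_vectors[of U UNIV] by (simp add: U_def T_def)
  moreover have "dim U \<le> m"
    using dim_le_card[of U "w ` {..<m}"] card_image_le[of "{..<m}" w]
    by (simp add: U_def)
  moreover have T: "subspace T"
    by (auto simp: T_def subspace_def orthogonal_clauses)
  have "dim {x + y |x y. x \<in> S \<and> y \<in> T} + dim (S \<inter> T) = dim S + dim T"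
    by (rule dim_sums_Int[OF assms T])
  moreover have "dim {x + y |x y. x \<in> S \<and> y \<in> T} \<le> DIM('a)"
    by (rule dim_subset_UNIV)
  moreover have "dim (S \<inter> T) \<le> dim {x \<in> S. \<forall>i<m. w i \<bullet> x = 0}"
    by (rule dim_subset) (auto simp: T_def U_def orthogonal_def span_base)
  ultimately show ?thesis by linarith
qed

text \<open>The Rayleigh quotient attains its minimum \<theta> on the compact unit sphere of
  \<open>S\<close>. Then \<open>f\<close> minus \<theta> is positive semidefinite with the minimiser
  as a null vector, so \<open>psd_on_null_vector\<close> makes it an eigenvector. The largest
  eigenvalue is obtained by negating the map.\<close>

lemma self_adjoint_on_min_eigenvector:
  fixes f :: "'a::euclidean_space \<Rightarrow> 'a"
  assumes S: "subspace S" "S \<noteq> {0}" and f: "self_adjoint_on S f"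
  obtains \<theta> x where "x \<in> S" "x \<noteq> 0" "f x = \<theta> *\<^sub>R x" "\<And>y. y \<in> S \<Longrightarrow> \<theta> * (y \<bullet> y) \<le> y \<bullet> f y"
proof -
  have lin: "linear f"
    using f by (simp add: self_adjoint_on_def)
  have normalize: "y /\<^sub>R norm y \<in> S \<inter> sphere 0 1" if "y \<in> S" "y \<noteq> 0" for y
    using that S(1) by (simp add: subspace_scale)
  obtain y where "y \<in> S" "y \<noteq> 0"
    using S subspace_0[OF S(1)] by blast
  then have "S \<inter> sphere 0 1 \<noteq> {}"
    using normalize by blast
  moreover have "compact (S \<inter> sphere 0 1)"
    by (intro closed_Int_compact closed_subspace S compact_sphere)
  moreover have "continuous_on (S \<inter> sphere 0 1) (\<lambda>x. x \<bullet> f x)"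
    by (intro continuous_intros linear_continuous_on linear_conv_bounded_linear[THEN iffD1] lin)
  ultimately obtain x where "x \<in> S \<inter> sphere 0 1"
    and min: "\<And>y. y \<in> S \<inter> sphere 0 1 \<Longrightarrow> x \<bullet> f x \<le> y \<bullet> f y"
    using continuous_attains_inf[of "S \<inter> sphere 0 1" "\<lambda>x. x \<bullet> f x"] by blast
  then have x: "x \<in> S" "norm x = 1"
    by auto
  define \<theta> where "\<theta> = x \<bullet> f x"
  have bound: "\<theta> * (y \<bullet> y) \<le> y \<bullet> f y" if "y \<in> S" for y
  proof (cases "y = 0")
    case False
    have "\<theta> \<le> (y \<bullet> f y) / (y \<bullet> y)"
      using min[OF normalize[OF that False]]
      by (simp add: \<theta>_def linear_scale[OF lin] divide_inverse dot_square_norm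
          power2_eq_square mult_ac)
    then show ?thesis
      using False by (simp add: le_divide_eq)
  qed simp
  define g where "g y = 1 *\<^sub>R f y + (- \<theta>) *\<^sub>R y" for y
  have "psd_on S g"
    using self_adjoint_on_affine[OF S(1) f, of 1 "- \<theta>"] bound
    by (simp add: psd_on_def g_def[abs_def] inner_diff_right)
  moreover have "x \<bullet> g x = 0"
    using x(2) by (simp add: g_def inner_diff_right \<theta>_def[symmetric] dot_square_norm)
  ultimately have "g x = 0"
    by (rule psd_on_null_vector[OF S(1) _ x(1)])
  then have "f x = \<theta> *\<^sub>R x"
    by (simp add: g_def)
  then show ?thesis
    using that x bound by (metis norm_zero zero_neq_one)
qed

section \<open>Dimensions of spaces of class functions and of hyperplane sections\<close>

lemma subspace_functions_const_on_fibres: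
  "subspace {x :: real ^ 'v::finite. \<forall>u v. c u = c v \<longrightarrow> x $ u = x $ v}" (is "subspace ?S")
proof (rule subspaceI)
  fix x y assume x: "x \<in> ?S" and y: "y \<in> ?S"
  show "x + y \<in> ?S"
  proof (intro CollectI allI impI)
    fix u v assume "c u = c v"
    then have "x $ u = x $ v" "y $ u = y $ v"
      using x y by blast+
    then show "(x + y) $ u = (x + y) $ v" by simp
  qed
next
  fix d x assume x: "x \<in> ?S"
  show "d *\<^sub>R x \<in> ?S"
  proof (intro CollectI allI impI)
    fix u v assume "c u = c v"
    then have "x $ u = x $ v"
      using x by blast
    then show "(d *\<^sub>R x) $ u = (d *\<^sub>R x) $ v" by simp
  qed
qed simp

text \<open>The indicator vectors of the nonempty fibres form an orthogonal basis. The classes will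
  be cliques or connected components.\<close>

lemma dim_functions_const_on_fibres:
  fixes c :: "'v::finite \<Rightarrow> 'b"
  shows "dim {x :: real ^ 'v. \<forall>u v. c u = c v \<longrightarrow> x $ u = x $ v} = card (range c)"
proof -
  define e :: "'b \<Rightarrow> real ^ 'v" where "e i = (\<chi> u. if c u = i then 1 else 0)" for i
  have orth: "e i \<bullet> e j = 0" if "i \<noteq> j" for i j
    using that by (auto simp: e_def inner_vec_def intro!: sum.neutral)
  have nz: "e i \<noteq> 0" if "i \<in> range c" for i
    using that by (auto simp: e_def vec_eq_iff)
  have inj: "inj_on e (range c)"
    by (intro inj_onI) (metis orth nz inner_eq_zero_iff)
  show ?thesis
  proof (rule dim_unique[of "e ` range c"])
    show "e ` range c \<subseteq> {x. \<forall>u v. c u = c v \<longrightarrow> x $ u = x $ v}"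
      by (auto simp: e_def)
    show "independent (e ` range c)"
    proof (rule pairwise_orthogonal_independent)
      show "pairwise orthogonal (e ` range c)"
      proof (rule pairwiseI)
        fix y z assume "y \<in> e ` range c" "z \<in> e ` range c" "y \<noteq> z"
        then obtain i j where "y = e i" "z = e j" by blast
        with \<open>y \<noteq> z\<close> show "orthogonal y z"
          by (auto simp: orthogonal_def intro!: orth)
      qed
      show "0 \<notin> e ` range c"
      proof
        assume "0 \<in> e ` range c"
        then obtain i where "0 = e i" "i \<in> range c"
          by (rule imageE)
        then show False
          using nz by metis
      qed
    qed
    show "card (e ` range c) = card (range c)"
      by (rule card_image[OF inj])
    show "{x. \<forall>u v. c u = c v \<longrightarrow> x $ u = x $ v} \<subseteq> span (e ` range c)"
    proof (intro subsetI, clarify)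
      fix x :: "real ^ 'v" assume x: "\<forall>u v. c u = c v \<longrightarrow> x $ u = x $ v"
      have "x = (\<Sum>i\<in>range c. x $ inv c i *\<^sub>R e i)"
      proof (subst vec_eq_iff, intro allI)
        fix u
        have "(\<Sum>i\<in>range c. x $ inv c i *\<^sub>R e i) $ u =
          (\<Sum>i\<in>range c. if i = c u then x $ inv c i else 0)"
          unfolding sum_component by (intro sum.cong refl) (auto simp: e_def)
        also have "\<dots> = x $ inv c (c u)"
          by (subst sum.delta) auto
        also have "\<dots> = x $ u"
          using x by (metis f_inv_into_f rangeI)
        finally show "x $ u = (\<Sum>i\<in>range c. x $ inv c i *\<^sub>R e i) $ u" ..
      qed
      also have "\<dots> \<in> span (e ` range c)"
        by (intro span_sum span_scale span_base) auto
      finally show "x \<in> span (e ` range c)" .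
    qed
  qed
qed

text \<open>Applied with the all-ones vector as \<open>a\<close>: a space that contains it loses
  exactly one dimension on restriction to \<open>zero_sum\<close>, which turns r into r - 1.\<close>

lemma dim_Int_hyperplane:
  fixes a :: "'a::euclidean_space"
  assumes "subspace S" "a \<in> S" "a \<noteq> 0"
  shows "dim (S \<inter> {x. a \<bullet> x = 0}) + 1 = dim S"
proof -
  have "{y \<in> S. \<forall>x\<in>span {a}. orthogonal x y} = S \<inter> {x. a \<bullet> x = 0}"
    by (auto simp: orthogonal_def span_singleton)
  moreover have "span {a} \<subseteq> S"
    using assms(1,2) by (simp add: span_minimal)
  ultimately show ?thesis
    using dim_subspace_orthogonal_to_vectors[of "span {a}" S] assms(1,3) by simp
qed

section \<open>Distance representations of regular graphs\<close>

definition zero_sum :: "(real ^ 'v::finite) set" where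
  "zero_sum = {x. 1 \<bullet> x = 0}"

lemma subspace_zero_sum: "subspace zero_sum"
  by (simp add: zero_sum_def subspace_hyperplane)

lemma dim_zero_sum: "dim (zero_sum :: (real ^ 'v::finite) set) = CARD('v) - 1"
proof -
  have "(1 :: real ^ 'v) \<noteq> 0"
    by (simp add: vec_eq_iff)
  then show ?thesis
    by (simp add: zero_sum_def dim_hyperplane)
qed

lemma inner_one_vec: "(1 :: real ^ 'v::finite) \<bullet> x = (\<Sum>u\<in>UNIV. x $ u)"
  by (simp add: inner_vec_def)

lemma zero_sum_iff: "x \<in> zero_sum \<longleftrightarrow> (\<Sum>u\<in>UNIV. x $ u) = 0"
  by (simp add: zero_sum_def inner_one_vec)

lemma axis_diff_in_zero_sum: "axis u 1 - axis v 1 \<in> zero_sum"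
  by (simp add: zero_sum_def inner_diff_right inner_axis)

text \<open>In the expanded square, each of the two pure terms leaves a factor that is the
  coordinate sum of \<open>x\<close> or of \<open>y\<close>, so only the cross term survives. This
  is Schoenberg's passage from squared distances to inner products, for one coordinate
  \<open>p\<close>.\<close>

lemma zero_sum_squared_differences:
  assumes "x \<in> zero_sum" "y \<in> zero_sum"
  shows "(\<Sum>u\<in>UNIV. \<Sum>v\<in>UNIV. x $ u * y $ v * (p u - p v)\<^sup>2) =
    - 2 * (\<Sum>u\<in>UNIV. p u * x $ u) * (\<Sum>v\<in>UNIV. p v * y $ v)"
proof -
  have "(\<Sum>u\<in>UNIV. \<Sum>v\<in>UNIV. x $ u * y $ v * (p u - p v)\<^sup>2) =
    (\<Sum>u\<in>UNIV. \<Sum>v\<in>UNIV. (x $ u * (p u)\<^sup>2) * y $ v + x $ u * (y $ v * (p v)\<^sup>2)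
      - 2 * ((p u * x $ u) * (p v * y $ v)))"
    by (intro sum.cong refl) (simp add: power2_eq_square algebra_simps)
  also have "\<dots> = (\<Sum>u\<in>UNIV. x $ u * (p u)\<^sup>2) * (\<Sum>v\<in>UNIV. y $ v)
      + (\<Sum>u\<in>UNIV. x $ u) * (\<Sum>v\<in>UNIV. y $ v * (p v)\<^sup>2)
      - 2 * ((\<Sum>u\<in>UNIV. p u * x $ u) * (\<Sum>v\<in>UNIV. p v * y $ v))"
    by (simp only: sum.distrib sum_subtractf sum_distrib_left[symmetric] sum_product)
  finally show ?thesis
    using assms by (simp add: zero_sum_iff)
qed

text \<open>The degree is a parameter, so that the complement is another instance and facts on
  non-adjacency can be read off from facts on adjacency.\<close>

locale regular_simple_graph =
  fixes G :: "'v::finite pair_pre_digraph" and k :: nat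
  assumes verts: "pverts G = UNIV"
    and arc_sym: "(u, v) \<in> parcs G \<Longrightarrow> (v, u) \<in> parcs G"
    and no_loop: "(u, u) \<notin> parcs G"
    and degree: "card {v. (u, v) \<in> parcs G} = k"
begin

abbreviation A :: "real ^ 'v ^ 'v" where
  "A \<equiv> adjacency_matrix G"

lemma arc_commute: "(u, v) \<in> parcs G \<longleftrightarrow> (v, u) \<in> parcs G"
  using arc_sym by blast

lemma A_nth: "A $ u $ v = (if (u, v) \<in> parcs G then 1 else 0)"
  by (simp add: adjacency_matrix_def)

lemma A_mult_nth: "(A *v x) $ u = (\<Sum>v | (u, v) \<in> parcs G. x $ v)"
  by (simp add: matrix_vector_mult_def A_nth if_distrib[of "\<lambda>t. t * _"] sum.If_cases cong: if_cong)

lemma A_mult_one: "A *v 1 = real k *\<^sub>R 1"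
  by (simp add: vec_eq_iff A_mult_nth degree)

lemma A_mult_axis: "(A *v axis v 1) $ u = (if (u, v) \<in> parcs G then 1 else 0)"
  by (simp add: matrix_vector_mult_basis column_def A_nth)

lemma inner_A_mult: "x \<bullet> (A *v y) = (\<Sum>u\<in>UNIV. \<Sum>v\<in>UNIV. A $ u $ v * (x $ u * y $ v))"
  by (simp add: inner_vec_def matrix_vector_mult_def sum_distrib_left mult_ac)

lemma A_self_adjoint: "(A *v x) \<bullet> y = x \<bullet> (A *v y)"
proof -
  have "(A *v x) \<bullet> y = (\<Sum>u\<in>UNIV. \<Sum>v\<in>UNIV. A $ u $ v * (y $ u * x $ v))"
    by (simp add: inner_commute[of _ y] inner_A_mult)
  also have "\<dots> = (\<Sum>v\<in>UNIV. \<Sum>u\<in>UNIV. A $ v $ u * (x $ v * y $ u))"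
    by (subst sum.swap) (simp add: A_nth arc_commute mult_ac)
  finally show ?thesis
    by (simp add: inner_A_mult)
qed

lemma A_self_adjoint_on_zero_sum: "self_adjoint_on zero_sum ((*v) A)"
proof -
  have "A *v x \<in> zero_sum" if "x \<in> zero_sum" for x
    using that A_self_adjoint[of 1 x, symmetric] by (simp add: zero_sum_def A_mult_one)
  then show ?thesis
    by (simp add: self_adjoint_on_def A_self_adjoint matrix_vector_mul_linear)
qed

text \<open>The mixed terms vanish because the all-ones vector is an eigenvector orthogonal to
  \<open>zero_sum\<close>. It permits test vectors with nonzero coordinate sum.\<close>

lemma A_quadratic_form_shift:
  "(x + c *\<^sub>R 1) \<bullet> (A *v (x + c *\<^sub>R 1)) = x \<bullet> (A *v x) + c\<^sup>2 * k * CARD('v)"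
  if "x \<in> zero_sum"
proof -
  have "(1 :: real ^ 'v) \<bullet> (A *v x) = 0" "(1 :: real ^ 'v) \<bullet> x = 0" "x \<bullet> 1 = 0"
    using that A_self_adjoint[of 1 x, symmetric]
    by (simp_all add: zero_sum_def A_mult_one inner_commute)
  then show ?thesis
    by (simp add: matrix_vector_right_distrib matrix_vector_mult_scaleR A_mult_one
        inner_add_left inner_add_right power2_eq_square inner_one_vec)
qed

text \<open>On \<^const>\<open>zero_sum\<close> this is minus the matrix of squared distances, for squared distance
  \<open>a\<close> between adjacent and \<open>b\<close> between non-adjacent vertices.\<close>

definition dist_form :: "real \<Rightarrow> real \<Rightarrow> real ^ 'v \<Rightarrow> real ^ 'v" where
  "dist_form a b x = (b - a) *\<^sub>R (A *v x) + b *\<^sub>R x"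

lemma inner_dist_form: "x \<bullet> dist_form a b y = (b - a) * (x \<bullet> (A *v y)) + b * (x \<bullet> y)"
  by (simp add: dist_form_def inner_add_right)

lemma self_adjoint_on_dist_form: "self_adjoint_on zero_sum (dist_form a b)"
  using self_adjoint_on_affine[OF subspace_zero_sum A_self_adjoint_on_zero_sum]
  by (simp add: dist_form_def[abs_def])

lemma dist_form_eq_0_iff:
  assumes "a \<noteq> b"
  shows "dist_form a b x = 0 \<longleftrightarrow> A *v x = (b / (a - b)) *\<^sub>R x"
proof -
  have "(b - a) * (b / (a - b)) = - b"
    using assms by (simp add: field_simps)
  then have "dist_form a b x = (b - a) *\<^sub>R (A *v x - (b / (a - b)) *\<^sub>R x)"
    by (simp only: dist_form_def scaleR_diff_right scaleR_scaleR) simp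
  then show ?thesis
    using assms by simp
qed

text \<open>The form determines all squared distances, up to the factor 2 that is divided out when
  points are built from it.\<close>

lemma inner_dist_form_axis_diff:
  assumes "u \<noteq> v"
  shows "(axis u 1 - axis v 1) \<bullet> dist_form a b (axis u 1 - axis v 1) =
    2 * (if (u, v) \<in> parcs G then a else b)"
  using assms no_loop arc_commute[of v u]
  by (simp add: inner_dist_form matrix_vector_mult_diff_distrib inner_diff_left inner_diff_right
      inner_axis' A_mult_axis) (simp add: axis_def)

text \<open>The double sum of the squared distances weighted by \<open>x\<close> and
  \<open>y\<close> is computed twice: from the two values \<open>a\<close> and \<open>b\<close>, and
  coordinate by coordinate.\<close>

lemma dist_form_gram:
  assumes f: "\<And>u v. u \<noteq> v \<Longrightarrow> (\<Sum>i<m. (f u i - f v i)\<^sup>2) = (if (u, v) \<in> parcs G then a else b)"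
    and x: "x \<in> zero_sum" and y: "y \<in> zero_sum"
  shows "x \<bullet> dist_form a b y =
    2 * (\<Sum>i<m. ((\<chi> u. f u i) \<bullet> x) * ((\<chi> u. f u i) \<bullet> y))"
proof -
  define D where "D u v = (\<Sum>i<m. (f u i - f v i)\<^sup>2)" for u v
  \<comment> \<open>As matrices, D = b J - b I - (b - a) A with J the all-ones matrix, and J drops
    out for zero-sum vectors.\<close>
  have D: "D u v = b - b * (if u = v then 1 else 0) - (b - a) * A $ u $ v" for u v
    using f[of u v] no_loop by (cases "u = v") (auto simp: D_def A_nth)
  have "(\<Sum>u\<in>UNIV. \<Sum>v\<in>UNIV. x $ u * y $ v * D u v) =
    (\<Sum>u\<in>UNIV. \<Sum>v\<in>UNIV. b * (x $ u * y $ v) - b * (if u = v then x $ u * y $ v else 0)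
      - (b - a) * (A $ u $ v * (x $ u * y $ v)))"
    by (intro sum.cong refl) (simp add: D algebra_simps)
  also have "\<dots> = b * ((\<Sum>u\<in>UNIV. x $ u) * (\<Sum>v\<in>UNIV. y $ v)) - b * (x \<bullet> y)
      - (b - a) * (x \<bullet> (A *v y))"
    unfolding sum_subtractf sum_distrib_left[symmetric] sum_product[symmetric] inner_A_mult
    by (simp add: inner_vec_def sum_distrib_right[symmetric])
  also have "\<dots> = - (x \<bullet> dist_form a b y)"
    using x by (simp add: zero_sum_iff inner_dist_form)
  finally have 1: "(\<Sum>u\<in>UNIV. \<Sum>v\<in>UNIV. x $ u * y $ v * D u v) = - (x \<bullet> dist_form a b y)" .
  have "(\<Sum>u\<in>UNIV. \<Sum>v\<in>UNIV. x $ u * y $ v * D u v) =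
    (\<Sum>u\<in>UNIV. \<Sum>i<m. \<Sum>v\<in>UNIV. x $ u * y $ v * (f u i - f v i)\<^sup>2)"
    unfolding D_def sum_distrib_left by (intro sum.cong refl sum.swap)
  also have "\<dots> = (\<Sum>i<m. \<Sum>u\<in>UNIV. \<Sum>v\<in>UNIV. x $ u * y $ v * (f u i - f v i)\<^sup>2)"
    by (rule sum.swap)
  also have "\<dots> = (\<Sum>i<m. - 2 * (((\<chi> u. f u i) \<bullet> x) * ((\<chi> u. f u i) \<bullet> y)))"
    by (simp only: zero_sum_squared_differences[OF x y]) (simp add: inner_vec_def mult.assoc)
  also have "\<dots> = - 2 * (\<Sum>i<m. ((\<chi> u. f u i) \<bullet> x) * ((\<chi> u. f u i) \<bullet> y))"
    by (simp only: sum_distrib_left)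
  finally show ?thesis
    using 1 by simp
qed

text \<open>Schoenberg's criterion, with \<open>a\<close> and \<open>b\<close> the squares of the
  two distances. The last inequality says that the rank on \<open>zero_sum\<close>, which has
  dimension \<open>CARD('v) - 1\<close>, is at most \<open>m\<close>.\<close>

lemma representable_iff:
  "representable G m \<longleftrightarrow>
    (\<exists>a b. 0 < a \<and> 0 < b \<and> a \<noteq> b \<and> psd_on zero_sum (dist_form a b) \<and>
      CARD('v) \<le> Suc m + dim {x \<in> zero_sum. dist_form a b x = 0})"
proof
  assume "representable G m"
  then obtain f :: "'v \<Rightarrow> nat \<Rightarrow> real" and \<alpha> \<beta> where pos: "0 < \<alpha>" "0 < \<beta>" "\<alpha> \<noteq> \<beta>"
    and f: "\<And>u v. u \<noteq> v \<Longrightarrow>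
      L2_set (\<lambda>i. f u i - f v i) {..<m} = (if (u, v) \<in> parcs G then \<alpha> else \<beta>)"
    unfolding representable_def verts by auto
  have sq: "(\<Sum>i<m. (f u i - f v i)\<^sup>2) = (if (u, v) \<in> parcs G then \<alpha>\<^sup>2 else \<beta>\<^sup>2)" if "u \<noteq> v" for u v
  proof -
    have "(\<Sum>i<m. (f u i - f v i)\<^sup>2) = (L2_set (\<lambda>i. f u i - f v i) {..<m})\<^sup>2"
      by (simp add: L2_set_def sum_nonneg)
    then show ?thesis
      by (simp add: f[OF that])
  qed
  define w where "w i = (\<chi> u. f u i)" for i
  define Q where "Q = dist_form (\<alpha>\<^sup>2) (\<beta>\<^sup>2)"
  have Q: "x \<bullet> Q y = 2 * (\<Sum>i<m. (w i \<bullet> x) * (w i \<bullet> y))" if "x \<in> zero_sum" "y \<in> zero_sum" for x y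
    using dist_form_gram[of f m "\<alpha>\<^sup>2" "\<beta>\<^sup>2" x y] sq that unfolding w_def Q_def by blast
  have psd: "psd_on zero_sum Q"
    using self_adjoint_on_dist_form[of "\<alpha>\<^sup>2" "\<beta>\<^sup>2", folded Q_def]
    by (simp add: psd_on_def Q sum_nonneg)
  \<comment> \<open>A zero-sum vector killed by all \<open>m\<close> coordinate forms is a null
    vector, hence in the kernel, whose codimension is therefore at most \<open>m\<close>.\<close>
  have "Q x = 0" if "x \<in> zero_sum" "\<forall>i<m. w i \<bullet> x = 0" for x
  proof (rule psd_on_null_vector[OF subspace_zero_sum psd that(1)])
    show "x \<bullet> Q x = 0"
      using Q[OF that(1) that(1)] that(2) by simp
  qed
  then have "dim {x \<in> zero_sum. \<forall>i<m. w i \<bullet> x = 0} \<le> dim {x \<in> zero_sum. Q x = 0}"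
    by (intro dim_subset) auto
  then have "CARD('v) \<le> Suc m + dim {x \<in> zero_sum. Q x = 0}"
    using dim_le_common_zeros[OF subspace_zero_sum, of m w] dim_zero_sum[where 'v='v] by linarith
  moreover have "\<alpha>\<^sup>2 \<noteq> \<beta>\<^sup>2"
    using pos by (simp add: power2_eq_iff)
  ultimately show "\<exists>a b. 0 < a \<and> 0 < b \<and> a \<noteq> b \<and> psd_on zero_sum (dist_form a b) \<and>
      CARD('v) \<le> Suc m + dim {x \<in> zero_sum. dist_form a b x = 0}"
    using pos psd unfolding Q_def by (intro exI[of _ "\<alpha>\<^sup>2"] exI[of _ "\<beta>\<^sup>2"]) auto
next
  assume "\<exists>a b. 0 < a \<and> 0 < b \<and> a \<noteq> b \<and> psd_on zero_sum (dist_form a b) \<and>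
      CARD('v) \<le> Suc m + dim {x \<in> zero_sum. dist_form a b x = 0}"
  then obtain a b where ab: "0 < a" "0 < b" "a \<noteq> b"
    and psd: "psd_on zero_sum (dist_form a b)"
    and m: "CARD('v) \<le> Suc m + dim {x \<in> zero_sum. dist_form a b x = 0}" by blast
  have "dim (zero_sum :: (real ^ 'v) set) \<le> m + dim {x \<in> zero_sum. dist_form a b x = 0}"
    using m unfolding dim_zero_sum by linarith
  then obtain w :: "nat \<Rightarrow> real ^ 'v"
    where w: "\<And>x. x \<in> zero_sum \<Longrightarrow> x \<bullet> dist_form a b x = (\<Sum>i<m. (w i \<bullet> x)\<^sup>2)"
    using psd_on_sum_of_squares[OF subspace_zero_sum psd] by blast
  \<comment> \<open>The linear forms of the sum of squares serve as coordinates;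
    \<open>sqrt 2\<close> cancels the factor in \<open>inner_dist_form_axis_diff\<close>.\<close>
  define f where "f u i = w i $ u / sqrt 2" for u i
  have L2: "L2_set (\<lambda>i. f u i - f v i) {..<m} = (if (u, v) \<in> parcs G then sqrt a else sqrt b)"
    if "u \<noteq> v" for u v
  proof -
    have "(\<Sum>i<m. (f u i - f v i)\<^sup>2) = (\<Sum>i<m. (w i \<bullet> (axis u 1 - axis v 1))\<^sup>2) / 2"
      unfolding sum_divide_distrib
      by (intro sum.cong refl)
        (simp add: f_def inner_diff_right inner_axis diff_divide_distrib[symmetric] power_divide)
    also have "\<dots> = (if (u, v) \<in> parcs G then a else b)"
      using inner_dist_form_axis_diff[OF that, of a b] w[OF axis_diff_in_zero_sum, of u v] by simp
    finally show ?thesis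
      by (simp add: L2_set_def)
  qed
  show "representable G m"
    unfolding representable_def
  proof (intro exI conjI ballI impI)
    show "0 < sqrt a" "0 < sqrt b" "sqrt a \<noteq> sqrt b"
      using ab by simp_all
  qed (rule L2)
qed

text \<open>Minimal dimension is maximal kernel. The additive form of the equation avoids truncated
  subtraction.\<close>

lemma Rep_eqI:
  assumes "0 < a" "0 < b" "a \<noteq> b" "psd_on zero_sum (dist_form a b)"
    and d: "dim {x \<in> zero_sum. dist_form a b x = 0} = d"
    and max: "\<And>a b. 0 < a \<Longrightarrow> 0 < b \<Longrightarrow> a \<noteq> b \<Longrightarrow> psd_on zero_sum (dist_form a b) \<Longrightarrow>
      dim {x \<in> zero_sum. dist_form a b x = 0} \<le> d"
  shows "Rep G + Suc d = CARD('v)"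
proof -
  have "d \<le> CARD('v) - 1"
    unfolding d[symmetric] dim_zero_sum[symmetric] by (rule dim_subset) auto
  moreover have "CARD('v) > 0"
    by simp
  ultimately have d_less: "Suc d \<le> CARD('v)"
    by linarith
  have "Rep G = CARD('v) - Suc d"
    unfolding Rep_def
  proof (rule Least_equality)
    show "representable G (CARD('v) - Suc d)"
      unfolding representable_iff using assms(1-4) d d_less
      by (intro exI[of _ a] exI[of _ b]) auto
    fix m assume "representable G m"
    then obtain a b where "CARD('v) \<le> Suc m + dim {x \<in> zero_sum. dist_form a b x = 0}"
      and "dim {x \<in> zero_sum. dist_form a b x = 0} \<le> d"
      unfolding representable_iff using max by blast
    then show "CARD('v) - Suc d \<le> m" by linarith
  qed
  then show ?thesis
    using d_less by simp
qed

lemma Rep_extreme_eigenvalues: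
  assumes x: "x \<in> zero_sum" "x \<noteq> 0" "A *v x = \<mu> *\<^sub>R x" and "\<mu> < -1"
    and lower: "\<And>z. z \<in> zero_sum \<Longrightarrow> \<mu> * (z \<bullet> z) \<le> z \<bullet> (A *v z)"
    and y: "y \<in> zero_sum" "y \<noteq> 0" "A *v y = \<nu> *\<^sub>R y" and "0 < \<nu>"
    and upper: "\<And>z. z \<in> zero_sum \<Longrightarrow> z \<bullet> (A *v z) \<le> \<nu> * (z \<bullet> z)"
  shows "Rep G + Suc (max (dim (zero_sum \<inter> eigenspace A \<mu>)) (dim (zero_sum \<inter> eigenspace A \<nu>)))
    = CARD('v)"
proof -
  define E where "E \<theta> = zero_sum \<inter> eigenspace A \<theta>" for \<theta>
  have ker: "{z \<in> zero_sum. dist_form a b z = 0} = E (b / (a - b))" if "a \<noteq> b" for a b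
    using that by (auto simp: dist_form_eq_0_iff E_def eigenspace_def)
  \<comment> \<open>Here and in \<open>psd_upper\<close>, \<open>b / (a - b)\<close> is \<mu> or
    \<nu>, normalised so that \<open>a\<close> and \<open>b\<close> differ by 1. Positivity of
    \<open>a\<close> in the first pair is exactly \<mu> < -1, positivity of \<open>b\<close> in the
    second is \<nu> > 0.\<close>
  have psd_lower: "psd_on zero_sum (dist_form (- \<mu> - 1) (- \<mu>))"
    using self_adjoint_on_dist_form lower by (simp add: psd_on_def inner_dist_form)
  have psd_upper: "psd_on zero_sum (dist_form (\<nu> + 1) \<nu>)"
    using self_adjoint_on_dist_form upper by (simp add: psd_on_def inner_dist_form)
  have max: "dim {z \<in> zero_sum. dist_form a b z = 0} \<le> max (dim (E \<mu>)) (dim (E \<nu>))"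
    if ab: "0 < a" "0 < b" "a \<noteq> b" and psd: "psd_on zero_sum (dist_form a b)" for a b
  proof (cases "\<exists>z\<in>zero_sum. z \<noteq> 0 \<and> dist_form a b z = 0")
    case True
    define \<theta> where "\<theta> = b / (a - b)"
    obtain z where z: "z \<in> zero_sum" "z \<noteq> 0" "A *v z = \<theta> *\<^sub>R z"
      using True ab(3) by (auto simp: dist_form_eq_0_iff \<theta>_def)
    have bound: "0 \<le> (b - a) * \<rho> + b" if "w \<in> zero_sum" "w \<noteq> 0" "A *v w = \<rho> *\<^sub>R w" for w \<rho>
    proof -
      have "0 \<le> ((b - a) * \<rho> + b) * (w \<bullet> w)"
        using psd that by (auto simp: psd_on_def inner_dist_form algebra_simps)
      then show ?thesis
        using that(2) inner_gt_zero_iff[of w] by (simp add: zero_le_mult_iff not_le[symmetric])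
    qed
    \<comment> \<open>As an eigenvalue on \<open>zero_sum\<close>, \<theta> lies between \<mu> and
      \<nu>. Semidefiniteness tested on \<open>x\<close> if \<open>a < b\<close>, and on
      \<open>y\<close> otherwise, gives the opposite inequality.\<close>
    have "\<theta> = \<mu> \<or> \<theta> = \<nu>"
    proof (cases "a < b")
      case True
      have "\<mu> \<le> \<theta>"
        using lower[OF z(1)] z by simp
      moreover have "\<theta> \<le> \<mu>"
        using bound[OF x] True by (simp add: \<theta>_def field_simps)
      ultimately show ?thesis by simp
    next
      case False
      have "\<theta> \<le> \<nu>"
        using upper[OF z(1)] z by simp
      moreover have "\<nu> \<le> \<theta>"
        using bound[OF y] False ab(3) by (simp add: \<theta>_def field_simps)
      ultimately show ?thesis by simp
    qed
    then show ?thesis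
      using ker[OF ab(3)] by (auto simp: \<theta>_def)
  next
    case False
    then have "{z \<in> zero_sum. dist_form a b z = 0} \<subseteq> {0}" by blast
    then have "dim {z \<in> zero_sum. dist_form a b z = 0} = 0"
      by (simp only: dim_eq_0)
    then show ?thesis by linarith
  qed
  have "Rep G + Suc (dim (E \<mu>)) = CARD('v)" if "dim (E \<nu>) \<le> dim (E \<mu>)"
  proof (rule Rep_eqI[OF _ _ _ psd_lower])
    show "dim {z \<in> zero_sum. dist_form (- \<mu> - 1) (- \<mu>) z = 0} = dim (E \<mu>)"
      by (simp add: ker)
  qed (use that max \<open>\<mu> < -1\<close> in \<open>auto simp: max_def\<close>)
  moreover have "Rep G + Suc (dim (E \<nu>)) = CARD('v)" if "dim (E \<mu>) \<le> dim (E \<nu>)"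
  proof (rule Rep_eqI[OF _ _ _ psd_upper])
    show "dim {z \<in> zero_sum. dist_form (\<nu> + 1) \<nu> z = 0} = dim (E \<nu>)"
      by (simp add: ker)
  qed (use that max \<open>0 < \<nu>\<close> in \<open>auto simp: max_def\<close>)
  ultimately show ?thesis
    unfolding E_def[symmetric] by (cases "dim (E \<nu>) \<le> dim (E \<mu>)") (simp_all add: max_def)
qed

end

section \<open>Disjoint unions of complete graphs\<close>

text \<open>A + I sums over classes, so its form is the sum of the squared class sums. Hence A lies
  between -1 and \<open>q - 1\<close>: no kernel arises for \<open>a < b\<close>, and for
  \<open>a > b\<close> the kernel consists of functions constant on the classes.\<close>

lemma Rep_disjoint_cliques:
  fixes G :: "'v::finite pair_pre_digraph" and c :: "'v \<Rightarrow> 'b"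
  assumes verts: "pverts G = UNIV"
    and arcs: "\<And>u v. (u, v) \<in> parcs G \<longleftrightarrow> u \<noteq> v \<and> c u = c v"
    and fibre: "\<And>u. card {v. c v = c u} = q" and q: "2 \<le> q"
  shows "Rep G + card (range c) = CARD('v)"
proof -
  have nbrs: "{v. (u, v) \<in> parcs G} = {v. c v = c u} - {u}" for u
    by (auto simp: arcs)
  interpret regular_simple_graph G "q - 1"
  proof
    show "card {v. (u, v) \<in> parcs G} = q - 1" for u
      by (simp add: nbrs fibre)
  qed (auto simp: verts arcs)
  have A: "(A *v x) $ u = (\<Sum>v | c v = c u. x $ v) - x $ u" for x u
    unfolding A_mult_nth nbrs by (simp add: sum_diff1)
  have form: "x \<bullet> (A *v x) = (\<Sum>i\<in>range c. (\<Sum>v | c v = i. x $ v)\<^sup>2) - x \<bullet> x" for x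
  proof -
    have "(\<Sum>u\<in>UNIV. x $ u * (\<Sum>v | c v = c u. x $ v)) =
      (\<Sum>i\<in>range c. \<Sum>u | c u = i. x $ u * (\<Sum>v | c v = c u. x $ v))"
      using sum.image_gen[of UNIV "\<lambda>u. x $ u * (\<Sum>v | c v = c u. x $ v)" c] by simp
    also have "\<dots> = (\<Sum>i\<in>range c. (\<Sum>v | c v = i. x $ v)\<^sup>2)"
      by (intro sum.cong refl) (simp add: power2_eq_square sum_distrib_right)
    finally show ?thesis
      by (simp add: inner_vec_def A right_diff_distrib sum_subtractf)
  qed
  have sq_norm: "x \<bullet> x = (\<Sum>i\<in>range c. \<Sum>u | c u = i. (x $ u)\<^sup>2)" for x :: "real ^ 'v"
    using sum.image_gen[of UNIV "\<lambda>u. (x $ u)\<^sup>2" c]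
    by (simp add: inner_vec_def power2_eq_square)
  have lower: "- (x \<bullet> x) \<le> x \<bullet> (A *v x)" for x
    by (simp add: form sum_nonneg)
  \<comment> \<open>Cauchy-Schwarz on each class of \<open>q\<close> vertices.\<close>
  have upper: "x \<bullet> (A *v x) \<le> (real q - 1) * (x \<bullet> x)" for x
  proof -
    have "(\<Sum>v | c v = i. x $ v)\<^sup>2 \<le> real q * (\<Sum>v | c v = i. (x $ v)\<^sup>2)" if "i \<in> range c" for i
      using that sum_squared_le_sum_of_squares[of "($) x" "{v. c v = i}"] fibre
      by (auto simp: mult.commute)
    then have "(\<Sum>i\<in>range c. (\<Sum>v | c v = i. x $ v)\<^sup>2) \<le> real q * (x \<bullet> x)"
      unfolding sq_norm sum_distrib_left by (rule sum_mono)
    then show ?thesis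
      by (simp add: form algebra_simps)
  qed
  define E where "E = {x :: real ^ 'v. \<forall>u v. c u = c v \<longrightarrow> x $ u = x $ v} \<inter> zero_sum"
  have "dim E + 1 = card (range c)"
  proof -
    have "dim E + 1 = dim {x :: real ^ 'v. \<forall>u v. c u = c v \<longrightarrow> x $ u = x $ v}"
      unfolding E_def zero_sum_def
      by (rule dim_Int_hyperplane[OF subspace_functions_const_on_fibres]) (auto simp: vec_eq_iff)
    then show ?thesis
      by (simp add: dim_functions_const_on_fibres)
  qed
  moreover have "Rep G + Suc (dim E) = CARD('v)"
  proof (rule Rep_eqI)
    show "0 < real q" "0 < real q - 1" "real q \<noteq> real q - 1"
      using q by auto
    show "psd_on zero_sum (dist_form (real q) (real q - 1))"
      using self_adjoint_on_dist_form upper by (simp add: psd_on_def inner_dist_form)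
    have eigenvector: "A *v x = (real q - 1) *\<^sub>R x" if "\<forall>u v. c u = c v \<longrightarrow> x $ u = x $ v" for x
    proof -
      have "(\<Sum>v | c v = c u. x $ v) = (\<Sum>v | c v = c u. x $ u)" for u
        using that by (intro sum.cong refl) blast
      then show ?thesis
        by (simp add: vec_eq_iff A fibre algebra_simps)
    qed
    \<comment> \<open>At \<open>u\<close> the eigenvalue equation says that
      \<open>(\<theta> + 1) * x $ u\<close> is the sum of \<open>x\<close> over the class of
      \<open>u\<close>, which depends on the class only.\<close>
    have const: "\<forall>u v. c u = c v \<longrightarrow> x $ u = x $ v"
      if "A *v x = \<theta> *\<^sub>R x" "\<theta> > 0" for x \<theta>
    proof (intro allI impI)
      fix u v assume "c u = c v"
      then have "(\<theta> + 1) * x $ u = (\<theta> + 1) * x $ v"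
        using A[of x u] A[of x v] that(1) by (simp add: algebra_simps)
      then show "x $ u = x $ v"
        using that(2) by simp
    qed
    have "dist_form (real q) (real q - 1) x = 0 \<longleftrightarrow> (\<forall>u v. c u = c v \<longrightarrow> x $ u = x $ v)" for x
    proof -
      have "dist_form (real q) (real q - 1) x = 0 \<longleftrightarrow> A *v x = (real q - 1) *\<^sub>R x"
        by (simp add: dist_form_eq_0_iff)
      moreover have "real q - 1 > 0"
        using q by simp
      ultimately show ?thesis
        using eigenvector const by blast
    qed
    then have "{x \<in> zero_sum. dist_form (real q) (real q - 1) x = 0} = E"
      unfolding E_def by blast
    then show "dim {x \<in> zero_sum. dist_form (real q) (real q - 1) x = 0} = dim E"
      by simp
    fix a b :: real assume ab: "0 < a" "0 < b" "a \<noteq> b"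
    show "dim {x \<in> zero_sum. dist_form a b x = 0} \<le> dim E"
    proof (cases "a < b")
      case True
      \<comment> \<open>For \<open>a < b\<close> the form is at least \<open>a\<close> times the
        squared norm, since A is bounded below by -1.\<close>
      have "x = 0" if "dist_form a b x = 0" for x
      proof -
        have "(b - a) * (- (x \<bullet> x)) \<le> (b - a) * (x \<bullet> (A *v x))"
          using True lower by (intro mult_left_mono) auto
        then have "a * (x \<bullet> x) \<le> x \<bullet> dist_form a b x"
          by (simp add: inner_dist_form algebra_simps)
        then have "\<not> x \<bullet> x > 0"
          using that ab(1) by (metis inner_zero_right mult_pos_pos not_le)
        then show "x = 0"
          by (simp only: inner_gt_zero_iff not_not)
      qed
      then have "{x \<in> zero_sum. dist_form a b x = 0} \<subseteq> {0}" by blast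
      then have "dim {x \<in> zero_sum. dist_form a b x = 0} = 0"
        by (simp only: dim_eq_0)
      then show ?thesis by linarith
    next
      case False
      then have "b / (a - b) > 0"
        using ab by simp
      then have "{x \<in> zero_sum. dist_form a b x = 0} \<subseteq> E"
        unfolding E_def dist_form_eq_0_iff[OF ab(3)] using const by blast
      then show ?thesis
        by (rule dim_subset)
    qed
  qed
  ultimately show ?thesis by simp
qed

text \<open>A library isomorphism also carries an arc map and new tail and head functions. Here both
  graphs have \<open>fst\<close> and \<open>snd\<close> as ends, which forces the arc map to be
  \<open>map_prod h h\<close> on the arcs.\<close>

lemma digraph_iso_with_proj_iff:
  assumes "wf_digraph (with_proj G)" and H: "parcs H \<subseteq> pverts H \<times> pverts H"
  shows "digraph_iso (with_proj G) (with_proj H) \<longleftrightarrow>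
    (\<exists>h. bij_betw h (pverts G) (pverts H) \<and>
      (\<forall>u\<in>pverts G. \<forall>v\<in>pverts G. (u, v) \<in> parcs G \<longleftrightarrow> (h u, h v) \<in> parcs H))"
proof
  assume "digraph_iso (with_proj G) (with_proj H)"
  then obtain f where f: "pre_digraph.digraph_isomorphism (with_proj G) f"
    and Hf: "with_proj H = app_iso f (with_proj G)"
    by (auto simp: digraph_iso_def)
  define h where "h = iso_verts f"
  have inj: "inj_on h (pverts G)"
    using f by (simp add: pre_digraph.digraph_isomorphism_def h_def)
  have pverts: "pverts H = h ` pverts G" and parcs: "parcs H = iso_arcs f ` parcs G"
    and ends: "iso_tail f = fst" "iso_head f = snd"
    using arg_cong[OF Hf, of verts] arg_cong[OF Hf, of arcs] arg_cong[OF Hf, of tail]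
      arg_cong[OF Hf, of head] by (simp_all add: h_def)
  have "h (fst e) = fst (iso_arcs f e) \<and> h (snd e) = snd (iso_arcs f e)" if "e \<in> parcs G" for e
    using f that by (simp add: pre_digraph.digraph_isomorphism_def h_def ends)
  then have "iso_arcs f e = map_prod h h e" if "e \<in> parcs G" for e
    using that by (simp add: prod_eq_iff)
  then have parcs: "parcs H = map_prod h h ` parcs G"
    unfolding parcs by (rule image_cong[OF refl])
  have "(u, v) \<in> parcs G" if "(h u, h v) \<in> parcs H" "u \<in> pverts G" "v \<in> pverts G" for u v
  proof -
    obtain u' v' where "(u', v') \<in> parcs G" "h u' = h u" "h v' = h v"
      using \<open>(h u, h v) \<in> parcs H\<close> unfolding parcs by auto
    moreover from this have "u' \<in> pverts G" "v' \<in> pverts G"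
      using wf_digraph.tail_in_verts[OF assms(1), of "(u', v')"]
        wf_digraph.head_in_verts[OF assms(1), of "(u', v')"] by auto
    ultimately show ?thesis
      using inj that(2,3) by (metis inj_onD)
  qed
  moreover have "(h u, h v) \<in> parcs H" if "(u, v) \<in> parcs G" for u v
    using that unfolding parcs by force
  moreover have "bij_betw h (pverts G) (pverts H)"
    by (simp add: bij_betw_def inj pverts)
  ultimately show "\<exists>h. bij_betw h (pverts G) (pverts H) \<and>
      (\<forall>u\<in>pverts G. \<forall>v\<in>pverts G. (u, v) \<in> parcs G \<longleftrightarrow> (h u, h v) \<in> parcs H)"
    by blast
next
  assume "\<exists>h. bij_betw h (pverts G) (pverts H) \<and>
      (\<forall>u\<in>pverts G. \<forall>v\<in>pverts G. (u, v) \<in> parcs G \<longleftrightarrow> (h u, h v) \<in> parcs H)"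
  then obtain h where h: "bij_betw h (pverts G) (pverts H)"
    and arc: "\<And>u v. u \<in> pverts G \<Longrightarrow> v \<in> pverts G \<Longrightarrow> (u, v) \<in> parcs G \<longleftrightarrow> (h u, h v) \<in> parcs H"
    by blast
  have inj: "inj_on h (pverts G)" and img: "pverts H = h ` pverts G"
    using h by (auto simp: bij_betw_def)
  have G: "parcs G \<subseteq> pverts G \<times> pverts G"
    using wf_digraph.tail_in_verts[OF assms(1)] wf_digraph.head_in_verts[OF assms(1)] by auto
  have "parcs H = map_prod h h ` parcs G"
  proof
    show "map_prod h h ` parcs G \<subseteq> parcs H"
      using G arc by auto
    show "parcs H \<subseteq> map_prod h h ` parcs G"
    proof
      fix e assume e: "e \<in> parcs H"
      then have "e \<in> h ` pverts G \<times> h ` pverts G"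
        using H img by blast
      then obtain u v where "u \<in> pverts G" "v \<in> pverts G" "e = (h u, h v)"
        by auto
      then show "e \<in> map_prod h h ` parcs G"
        using arc[of u v] e by force
    qed
  qed
  moreover have "inj_on (map_prod h h) (parcs G)"
    using map_prod_inj_on[OF inj inj] G by (rule inj_on_subset)
  moreover define f where
    "f = \<lparr>iso_verts = h, iso_arcs = map_prod h h, iso_head = snd, iso_tail = fst\<rparr>"
  ultimately have "pre_digraph.digraph_isomorphism (with_proj G) f"
    and "with_proj H = app_iso f (with_proj G)"
    by (simp_all add: pre_digraph.digraph_isomorphism_def assms(1) inj)
      (simp add: img app_iso_def with_proj_def)
  then show "digraph_iso (with_proj G) (with_proj H)"
    by (auto simp: digraph_iso_def)
qed

text \<open>The same points represent the complement, with the two distances exchanged.\<close>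

lemma Rep_graph_complement: "Rep (graph_complement G) = Rep G"
proof -
  have *: "representable (graph_complement G) m" if "representable G m" for G :: "'a pair_pre_digraph" and m
    using that unfolding representable_def[of G]
  proof (elim exE conjE)
    fix f :: "'a \<Rightarrow> nat \<Rightarrow> real" and \<alpha> \<beta> :: real
    assume "0 < \<alpha>" "0 < \<beta>" "\<alpha> \<noteq> \<beta>"
      and "\<forall>u\<in>pverts G. \<forall>v\<in>pverts G. u \<noteq> v \<longrightarrow>
        L2_set (\<lambda>i. f u i - f v i) {..<m} = (if (u, v) \<in> parcs G then \<alpha> else \<beta>)"
    then show ?thesis
      unfolding representable_def
      by (intro exI[of _ f] exI[of _ \<beta>] exI[of _ \<alpha>]) (auto simp: graph_complement_def)
  qed
  have "representable G m" if "representable (graph_complement G) m" for m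
  proof -
    have "representable (graph_complement (graph_complement G)) m"
      using * that .
    \<comment> \<open>For an arbitrary \<open>G\<close> the double complement may differ from
      \<open>G\<close> in loops or stray arcs, but \<open>representable\<close> looks only at pairs
      of distinct vertices.\<close>
    moreover have "representable (graph_complement (graph_complement G)) m = representable G m"
      by (auto simp: representable_def graph_complement_def cong: conj_cong imp_cong)
    ultimately show ?thesis by simp
  qed
  then have "representable (graph_complement G) = representable G"
    using * by blast
  then show ?thesis
    by (simp add: Rep_def)
qed

lemma parcs_graph_complement:
  assumes "pverts G = UNIV"
  shows "(u, v) \<in> parcs (graph_complement G) \<longleftrightarrow> u \<noteq> v \<and> (u, v) \<notin> parcs G"
  using assms by (simp add: graph_complement_def)

section \<open>Recognising disjoint unions of equal cliques and their complements\<close>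

context regular_simple_graph
begin

lemma wf_digraph: "wf_digraph (with_proj G)"
  by unfold_locales (simp_all add: verts)

text \<open>Isomorphism becomes a numbering of the vertices in which \<open>fst (h u)\<close> is the
  copy that contains \<open>u\<close>.\<close>

lemma is_copies_or_complement_iff:
  "is_copies_or_complement G r \<longleftrightarrow>
    (\<exists>h. bij_betw h UNIV ({..<r} \<times> {..<CARD('v) div r}) \<and>
      ((\<forall>u v. (u, v) \<in> parcs G \<longleftrightarrow> u \<noteq> v \<and> fst (h u) = fst (h v)) \<or>
       (\<forall>u v. (u, v) \<in> parcs G \<longleftrightarrow> fst (h u) \<noteq> fst (h v))))"
proof -
  define q where "q = CARD('v) div r"
  define H where "H = copies_of_complete r q"
  have pverts: "pverts H = {..<r} \<times> {..<q}" "pverts (graph_complement H) = {..<r} \<times> {..<q}"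
    by (simp_all add: H_def copies_of_complete_def graph_complement_def)
  have parcs: "parcs H \<subseteq> pverts H \<times> pverts H"
    "parcs (graph_complement H) \<subseteq> pverts (graph_complement H) \<times> pverts (graph_complement H)"
    by (auto simp: H_def copies_of_complete_def graph_complement_def)
  have arc: "(h u, h v) \<in> parcs H \<longleftrightarrow> u \<noteq> v \<and> fst (h u) = fst (h v)"
    "(h u, h v) \<in> parcs (graph_complement H) \<longleftrightarrow> fst (h u) \<noteq> fst (h v)"
    if h: "bij_betw h UNIV ({..<r} \<times> {..<q})" for h and u v :: 'v
  proof -
    have "h u \<in> {..<r} \<times> {..<q}" "h v \<in> {..<r} \<times> {..<q}"
      using bij_betwE[OF h] by blast+
    moreover have "h u = h v \<longleftrightarrow> u = v"
      using bij_betw_imp_inj_on[OF h] by (simp add: inj_eq)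
    ultimately show "(h u, h v) \<in> parcs H \<longleftrightarrow> u \<noteq> v \<and> fst (h u) = fst (h v)"
      "(h u, h v) \<in> parcs (graph_complement H) \<longleftrightarrow> fst (h u) \<noteq> fst (h v)"
      by (cases "h u"; cases "h v"; auto simp: H_def copies_of_complete_def graph_complement_def)+
  qed
  show ?thesis
    unfolding is_copies_or_complement_def Let_def verts q_def[symmetric] H_def[symmetric]
      digraph_iso_with_proj_iff[OF wf_digraph parcs(1)]
      digraph_iso_with_proj_iff[OF wf_digraph parcs(2)] pverts
    using arc by (simp cong: conj_cong) blast
qed

lemma Rep_copies_or_complement:
  assumes r: "is_copies_or_complement G r" "r \<noteq> CARD('v)"
  shows "Rep G + r = CARD('v)"
proof -
  define q where "q = CARD('v) div r"
  obtain h where h: "bij_betw h UNIV ({..<r} \<times> {..<q})"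
    and arcs: "(\<forall>u v. (u, v) \<in> parcs G \<longleftrightarrow> u \<noteq> v \<and> fst (h u) = fst (h v)) \<or>
       (\<forall>u v. (u, v) \<in> parcs G \<longleftrightarrow> fst (h u) \<noteq> fst (h v))"
    using r(1) unfolding is_copies_or_complement_iff q_def[symmetric]
    by (elim exE conjE) (rule that)
  define c where "c u = fst (h u)" for u
  \<comment> \<open>The bijection makes r a divisor of the number of vertices;
    \<open>r \<noteq> CARD('v)\<close> then excludes cliques of size 1.\<close>
  have rq: "CARD('v) = r * q"
    using bij_betw_same_card[OF h] by (simp add: card_cartesian_product)
  moreover have "CARD('v) > 0"
    by simp
  ultimately have "q > 0" "q \<noteq> 1"
    using r(2) by (metis mult_0_right less_irrefl neq0_conv, metis mult_1_right)
  then have q: "2 \<le> q" by simp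
  have "range c = fst ` ({..<r} \<times> {..<q})"
    using h unfolding c_def bij_betw_def by (metis image_image)
  then have range: "card (range c) = r"
    using \<open>q > 0\<close> by (auto simp: lessThan_empty_iff bot_nat_def)
  have h_mem: "h u \<in> {..<r} \<times> {..<q}" for u
    using bij_betwE[OF h] by blast
  have fibre: "card {v. c v = c u} = q" for u
  proof -
    have "h ` {v. c v = c u} = {c u} \<times> {..<q}"
    proof
      show "h ` {v. c v = c u} \<subseteq> {c u} \<times> {..<q}"
      proof (rule image_subsetI)
        fix v assume "v \<in> {v. c v = c u}"
        then show "h v \<in> {c u} \<times> {..<q}"
          using h_mem[of v] by (auto simp: c_def mem_Times_iff)
      qed
      show "{c u} \<times> {..<q} \<subseteq> h ` {v. c v = c u}"
      proof
        fix p assume p: "p \<in> {c u} \<times> {..<q}"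
        moreover have "c u < r"
          using h_mem[of u] by (auto simp: c_def mem_Times_iff)
        ultimately have "p \<in> range h"
          using bij_betw_imp_surj_on[OF h] by auto
        then obtain v where v: "p = h v" by blast
        moreover have "c v = c u"
          using p by (simp add: c_def v mem_Times_iff)
        ultimately show "p \<in> h ` {v. c v = c u}" by blast
      qed
    qed
    moreover have "inj_on h {v. c v = c u}"
      using h by (auto simp: bij_betw_def intro: inj_on_subset)
    ultimately show ?thesis
      by (metis card_image card_cartesian_product_singleton card_lessThan)
  qed
  from arcs show ?thesis
  proof
    assume "\<forall>u v. (u, v) \<in> parcs G \<longleftrightarrow> u \<noteq> v \<and> fst (h u) = fst (h v)"
    then show ?thesis
      using Rep_disjoint_cliques[OF verts, of c] fibre q range by (simp add: c_def)
  next
    assume "\<forall>u v. (u, v) \<in> parcs G \<longleftrightarrow> fst (h u) \<noteq> fst (h v)"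
    then have "(u, v) \<in> parcs (graph_complement G) \<longleftrightarrow> u \<noteq> v \<and> c u = c v" for u v
      by (simp add: parcs_graph_complement verts c_def)
    moreover have "pverts (graph_complement G) = UNIV"
      by (simp add: graph_complement_def verts)
    ultimately have "Rep (graph_complement G) + card (range c) = CARD('v)"
      using fibre q by (intro Rep_disjoint_cliques)
    then show ?thesis
      by (simp add: range Rep_graph_complement)
  qed
qed

text \<open>Closed neighbourhoods are the classes of an equivalence relation, all of size
  \<open>Suc k\<close> by regularity. Numbering the classes by \<open>g\<close> and the members of
  each class by \<open>p\<close> gives the isomorphism.\<close>

lemma is_copies_if_transitive:
  assumes trans: "\<And>u v w. (u, v) \<in> parcs G \<Longrightarrow> (v, w) \<in> parcs G \<Longrightarrow> u \<noteq> w \<Longrightarrow> (u, w) \<in> parcs G"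
  obtains r where "is_copies_or_complement G r" "CARD('v) = r * Suc k"
proof -
  define c where "c u = insert u {v. (u, v) \<in> parcs G}" for u
  have c_eq: "c u = c v \<longleftrightarrow> u = v \<or> (u, v) \<in> parcs G" for u v
  proof
    assume "c u = c v"
    then have "v \<in> c u"
      by (simp add: c_def)
    then show "u = v \<or> (u, v) \<in> parcs G"
      by (auto simp: c_def)
  next
    have sub: "c u \<subseteq> c v" if "(v, u) \<in> parcs G" for u v
      using that trans by (auto simp: c_def)
    assume "u = v \<or> (u, v) \<in> parcs G"
    then show "c u = c v"
      using sub arc_sym by blast
  qed
  have fibre: "card {v. c v = c u} = Suc k" for u
  proof -
    have "{v. c v = c u} = insert u {v. (u, v) \<in> parcs G}"
      using arc_commute by (auto simp: c_eq)
    then show ?thesis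
      by (simp add: no_loop degree)
  qed
  define r where "r = card (range c)"
  have "CARD('v) = (\<Sum>i\<in>range c. card {v. c v = i})"
    using sum.image_gen[of UNIV "\<lambda>_. 1::nat" c] by simp
  also have "\<dots> = (\<Sum>i\<in>range c. Suc k)"
    by (intro sum.cong refl) (auto simp: fibre)
  finally have card: "CARD('v) = r * Suc k"
    by (simp add: r_def)
  have "\<exists>g. bij_betw g (range c) {..<r}"
    using ex_bij_betw_finite_nat[of "range c"] by (simp add: r_def atLeast0LessThan)
  then obtain g where g: "bij_betw g (range c) {..<r}" by blast
  have "\<exists>p. bij_betw p {v. c v = c u} {..<Suc k}" for u
    using ex_bij_betw_finite_nat[of "{v. c v = c u}"] by (simp add: fibre atLeast0LessThan)
  then have "\<forall>i\<in>range c. \<exists>p. bij_betw p {v. c v = i} {..<Suc k}"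
    by blast
  then obtain p where p: "\<And>i. i \<in> range c \<Longrightarrow> bij_betw (p i) {v. c v = i} {..<Suc k}"
    by metis
  define h where "h u = (g (c u), p (c u) u)" for u
  have fst_h: "fst (h u) = fst (h v) \<longleftrightarrow> c u = c v" for u v
    using g by (auto simp: h_def bij_betw_def inj_on_def)
  have "inj h"
  proof (rule injI)
    fix u v assume "h u = h v"
    then have "c u = c v"
      using fst_h by metis
    moreover from this have "p (c u) u = p (c u) v"
      using \<open>h u = h v\<close> by (simp add: h_def)
    ultimately show "u = v"
      using p[of "c u"] by (auto simp: bij_betw_def inj_on_def)
  qed
  moreover have "range h = {..<r} \<times> {..<Suc k}"
  proof (rule card_subset_eq)
    show "range h \<subseteq> {..<r} \<times> {..<Suc k}"
      using bij_betwE[OF g] bij_betwE[OF p] by (fastforce simp: h_def)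
    show "card (range h) = card ({..<r} \<times> {..<Suc k})"
      using \<open>inj h\<close> card by (simp add: card_image card_cartesian_product)
  qed simp
  moreover have "CARD('v) div r = Suc k"
    using card by (metis nonzero_mult_div_cancel_left mult_0 zero_less_card_finite less_irrefl)
  ultimately have "is_copies_or_complement G r"
    unfolding is_copies_or_complement_iff
    by (intro exI[of _ h]) (auto simp: bij_betw_def fst_h c_eq no_loop)
  with that card show ?thesis by blast
qed

lemma graph_complement_regular: "regular_simple_graph (graph_complement G) (CARD('v) - Suc k)"
proof
  have "{v. (u, v) \<in> parcs (graph_complement G)} = UNIV - insert u {v. (u, v) \<in> parcs G}" for u
    by (auto simp: parcs_graph_complement verts)
  then show "card {v. (u, v) \<in> parcs (graph_complement G)} = CARD('v) - Suc k" for u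
    by (simp only:) (simp add: card_Diff_subset no_loop degree)
qed (auto simp: graph_complement_def verts arc_sym)

text \<open>Complementation exchanges the two alternatives and keeps the same
  \<open>h\<close>.\<close>

lemma is_copies_or_complement_graph_complement:
  "is_copies_or_complement (graph_complement G) r \<longleftrightarrow> is_copies_or_complement G r"
proof -
  have copies: "((u, v) \<in> parcs (graph_complement G) \<longleftrightarrow> u \<noteq> v \<and> fst (h u) = fst (h v)) \<longleftrightarrow>
      ((u, v) \<in> parcs G \<longleftrightarrow> fst (h u) \<noteq> fst (h v))"
    and complement: "((u, v) \<in> parcs (graph_complement G) \<longleftrightarrow> fst (h u) \<noteq> fst (h v)) \<longleftrightarrow>
      ((u, v) \<in> parcs G \<longleftrightarrow> u \<noteq> v \<and> fst (h u) = fst (h v))" for h :: "'v \<Rightarrow> nat \<times> nat" and u v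
    by (auto simp: parcs_graph_complement verts no_loop)
  show ?thesis
    unfolding is_copies_or_complement_iff
      regular_simple_graph.is_copies_or_complement_iff[OF graph_complement_regular] copies complement
    by blast
qed

end

section \<open>Eigenvalues of regular graphs\<close>

context regular_simple_graph
begin

lemma subspace_eigenspace: "subspace (eigenspace A \<theta>)"
  by (auto simp: eigenspace_def subspace_def matrix_vector_right_distrib
      matrix_vector_mult_scaleR scaleR_add_right)

lemma eigenvalues_iff: "\<theta> \<in> eigenvalues A \<longleftrightarrow> (\<exists>x\<in>eigenspace A \<theta>. x \<noteq> 0)"
  by (auto simp: eigenvalues_def eigenspace_def)

text \<open>Eigenvectors of a symmetric matrix for different eigenvalues are orthogonal, and the
  all-ones vector belongs to \<open>k\<close>. So multiplicities on \<open>zero_sum\<close> are the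
  true ones except at \<open>k\<close>.\<close>

lemma eigenspace_subset_zero_sum:
  assumes "\<theta> \<noteq> real k"
  shows "eigenspace A \<theta> \<subseteq> zero_sum"
proof
  fix x assume "x \<in> eigenspace A \<theta>"
  then have "real k * (1 \<bullet> x) = \<theta> * (1 \<bullet> x)"
    using A_self_adjoint[of 1 x] by (simp add: A_mult_one eigenspace_def)
  then show "x \<in> zero_sum"
    using assms by (simp add: zero_sum_def)
qed

text \<open>The Laplacian k I - A as a sum of squares over arcs, each edge counted twice.
  Nonnegativity bounds the eigenvalues by \<open>k\<close>, and the case of equality describes the
  eigenspace of \<open>k\<close>.\<close>

lemma laplacian_form:
  "(\<Sum>u\<in>UNIV. \<Sum>v\<in>UNIV. A $ u $ v * (x $ u - x $ v)\<^sup>2) = 2 * (k * (x \<bullet> x) - x \<bullet> (A *v x))"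
proof -
  have row: "(\<Sum>v\<in>UNIV. A $ u $ v) = k" for u
    using A_mult_one by (simp add: vec_eq_iff matrix_vector_mult_def)
  have sym: "A $ u $ v = A $ v $ u" for u v
    by (simp add: A_nth arc_commute[of u v])
  have 1: "(\<Sum>u\<in>UNIV. \<Sum>v\<in>UNIV. A $ u $ v * (x $ u)\<^sup>2) = k * (x \<bullet> x)"
    by (simp add: sum_distrib_right[symmetric] row inner_vec_def sum_distrib_left power2_eq_square)
  have "(\<Sum>u\<in>UNIV. \<Sum>v\<in>UNIV. A $ u $ v * (x $ v)\<^sup>2) =
    (\<Sum>v\<in>UNIV. \<Sum>u\<in>UNIV. A $ v $ u * (x $ v)\<^sup>2)"
    by (subst sum.swap) (simp only: sym)
  then have 2: "(\<Sum>u\<in>UNIV. \<Sum>v\<in>UNIV. A $ u $ v * (x $ v)\<^sup>2) = k * (x \<bullet> x)"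
    by (simp only: 1)
  have "(\<Sum>u\<in>UNIV. \<Sum>v\<in>UNIV. A $ u $ v * (x $ u - x $ v)\<^sup>2) =
    (\<Sum>u\<in>UNIV. \<Sum>v\<in>UNIV. A $ u $ v * (x $ u)\<^sup>2 + A $ u $ v * (x $ v)\<^sup>2
      - 2 * (A $ u $ v * (x $ u * x $ v)))"
    by (intro sum.cong refl) (simp add: power2_eq_square algebra_simps)
  also have "\<dots> = k * (x \<bullet> x) + k * (x \<bullet> x) - 2 * (x \<bullet> (A *v x))"
    by (simp only: sum_subtractf sum.distrib 1 2 sum_distrib_left[symmetric] inner_A_mult)
  finally show ?thesis by simp
qed

lemma A_le_degree: "x \<bullet> (A *v x) \<le> k * (x \<bullet> x)"
proof -
  have "0 \<le> (\<Sum>u\<in>UNIV. \<Sum>v\<in>UNIV. A $ u $ v * (x $ u - x $ v)\<^sup>2)"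
    by (intro sum_nonneg) (simp add: A_nth)
  then show ?thesis
    by (simp add: laplacian_form)
qed

lemma sym_digraph: "sym_digraph (with_proj G)"
  by unfold_locales (auto simp: verts symmetric_def sym_def arc_sym)

text \<open>If the Laplacian form vanishes, every term does, so \<open>x\<close> agrees across arcs
  and hence along paths. As arcs are symmetric, the strong components are the connected
  components.\<close>

lemma eigenspace_degree:
  "eigenspace A k = {x. \<forall>u v. pre_digraph.scc_of (with_proj G) u = pre_digraph.scc_of (with_proj G) v
    \<longrightarrow> x $ u = x $ v}" (is "_ = ?S")
proof
  interpret sym_digraph "with_proj G"
    by (rule sym_digraph)
  show "eigenspace A k \<subseteq> ?S"
  proof
    fix x assume "x \<in> eigenspace A k"
    then have "(\<Sum>u\<in>UNIV. \<Sum>v\<in>UNIV. A $ u $ v * (x $ u - x $ v)\<^sup>2) = 0"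
      unfolding laplacian_form by (simp add: eigenspace_def)
    then have "(\<Sum>v\<in>UNIV. A $ u $ v * (x $ u - x $ v)\<^sup>2) = 0" for u
      by (rule sum_nonneg_0[rotated 2]) (auto intro!: sum_nonneg simp: A_nth)
    then have "A $ u $ v * (x $ u - x $ v)\<^sup>2 = 0" for u v
      by (rule sum_nonneg_0[rotated 2]) (auto simp: A_nth)
    then have adj: "x $ u = x $ v" if "(u, v) \<in> parcs G" for u v
      using that by (metis A_nth mult_1 power_eq_0_iff right_minus_eq)
    have reach: "x $ u = x $ v" if "u \<rightarrow>\<^sup>*\<^bsub>with_proj G\<^esub> v" for u v
      using that
    proof (induction rule: reachable_induct)
      case (step v w)
      then show ?case
        using adj[of v w] by simp
    qed simp
    have "x $ u = x $ v" if "scc_of u = scc_of v" for u v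
    proof -
      have "v \<in> scc_of u"
        using that in_scc_of_self[of v] by (simp add: verts)
      then show ?thesis
        using reach by (simp add: scc_of_def)
    qed
    then show "x \<in> ?S" by blast
  qed
  show "?S \<subseteq> eigenspace A k"
  proof
    fix x assume x: "x \<in> ?S"
    have "x $ v = x $ u" if "(u, v) \<in> parcs G" for u v
    proof -
      have "u \<rightarrow>\<^sup>*\<^bsub>with_proj G\<^esub> v" "v \<rightarrow>\<^sup>*\<^bsub>with_proj G\<^esub> u"
        using that arc_sym by (auto intro!: reachable_adjI)
      then have "scc_of v = scc_of u"
        unfolding scc_of_def by (auto intro: reachable_trans)
      then show ?thesis
        using x by blast
    qed
    then have "(A *v x) $ u = real k * x $ u" for u
      unfolding A_mult_nth by (simp add: degree)
    then show "x \<in> eigenspace A k"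
      by (simp add: eigenspace_def vec_eq_iff)
  qed
qed

lemma multiplicity_degree:
  "eigenvalue_multiplicity A k = card (pre_digraph.sccs_verts (with_proj G))"
  unfolding eigenvalue_multiplicity_def eigenspace_degree dim_functions_const_on_fibres
    wf_digraph.sccs_verts_conv_scc_of[OF wf_digraph] by (simp add: verts)

lemma dim_zero_sum_Int_eigenspace_degree:
  "dim (zero_sum \<inter> eigenspace A k) + 1 = card (pre_digraph.sccs_verts (with_proj G))"
proof -
  have "dim (eigenspace A k \<inter> {x. 1 \<bullet> x = 0}) + 1 = dim (eigenspace A k)"
    by (rule dim_Int_hyperplane[OF subspace_eigenspace])
      (simp_all add: eigenspace_def A_mult_one vec_eq_iff)
  then show ?thesis
    using multiplicity_degree by (simp add: eigenvalue_multiplicity_def zero_sum_def Int_commute)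
qed

lemma connected_iff_card_sccs_verts:
  "Digraph_Component.connected (with_proj G) \<longleftrightarrow>
    card (pre_digraph.sccs_verts (with_proj G)) = 1"
proof -
  interpret sym_digraph "with_proj G"
    by (rule sym_digraph)
  have sccs: "sccs_verts = range scc_of"
    by (simp add: sccs_verts_conv_scc_of verts)
  show ?thesis
  proof
    assume "Digraph_Component.connected (with_proj G)"
    then have "strongly_connected (with_proj G)"
      by (rule symmetric_connected_imp_strongly_connected[OF sym_arcs])
    then have "scc_of u = UNIV" for u
      by (auto simp: strongly_connected_def scc_of_def verts)
    then show "card sccs_verts = 1"
      by (simp add: sccs)
  next
    assume "card sccs_verts = 1"
    then obtain S where S: "range scc_of = {S}"
      unfolding sccs by (rule card_1_singletonE)
    have "u \<rightarrow>\<^sup>*\<^bsub>with_proj G\<^esub> v" for u v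
    proof -
      have "scc_of u = scc_of v"
        using S by blast
      then have "v \<in> scc_of u"
        using in_scc_of_self[of v] by (simp add: verts)
      then show ?thesis
        by (simp add: scc_of_def)
    qed
    then have "strongly_connected (with_proj G)"
      by (simp add: strongly_connected_def verts)
    then show "Digraph_Component.connected (with_proj G)"
      by (intro connectedI) (simp_all add: verts strongly_connected_def reachable_mk_symmetric_eq[OF sym_arcs])
  qed
qed

text \<open>The test vectors are \<open>e\<^sub>u - e\<^sub>v + e\<^sub>w\<close> for a path \<open>u v w\<close>, and
  \<open>e\<^sub>u - 2 e\<^sub>v + e\<^sub>w\<close> for \<open>v\<close> adjacent to neither end of the edge \<open>u w\<close>.\<close>

lemma transitive_if_ge_minus_one:
  assumes lower: "\<And>z. z \<in> zero_sum \<Longrightarrow> - (z \<bullet> z) \<le> z \<bullet> (A *v z)"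
    and arcs: "(u, v) \<in> parcs G" "(v, w) \<in> parcs G" and "u \<noteq> w"
  shows "(u, w) \<in> parcs G"
proof (rule ccontr)
  assume uw: "(u, w) \<notin> parcs G"
  have distinct: "u \<noteq> v" "v \<noteq> w"
    using arcs no_loop by auto
  define y where "y = axis u 1 - axis v 1 + axis w (1 :: real)"
  \<comment> \<open>The vector \<open>y\<close> has coordinate sum 1, and \<open>z\<close> is its
    projection to \<open>zero_sum\<close>. Restoring the constant part decreases neither quadratic
    form, so it suffices that they add up to 3 - 4 < 0 on \<open>y\<close>.\<close>
  define d where "d = 1 / real CARD('v)"
  define z where "z = y - d *\<^sub>R 1"
  have "1 \<bullet> y = 1"
    by (simp add: y_def inner_diff_right inner_add_right inner_axis)
  moreover have one: "(1 :: real ^ 'v) \<bullet> 1 = CARD('v)"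
    by (simp add: inner_one_vec)
  ultimately have z: "z \<in> zero_sum"
    by (simp add: zero_sum_def z_def d_def inner_diff_right)
  have y: "y = z + d *\<^sub>R 1"
    by (simp add: z_def)
  have "z \<bullet> 1 = 0"
    using z by (simp add: zero_sum_def inner_commute)
  then have "z \<bullet> z \<le> y \<bullet> y"
    using z by (simp add: y inner_add_left inner_add_right zero_sum_def one d_def)
  moreover have "z \<bullet> (A *v z) \<le> y \<bullet> (A *v y)"
    unfolding y A_quadratic_form_shift[OF z] by simp
  ultimately have "0 \<le> y \<bullet> (A *v y) + y \<bullet> y"
    using lower[OF z] by linarith
  also have "y \<bullet> y = 3"
    using distinct \<open>u \<noteq> w\<close>
    by (simp add: y_def inner_diff_left inner_diff_right inner_add_left inner_add_right
        inner_axis_axis)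
  also have "y \<bullet> (A *v y) = -4"
    using distinct \<open>u \<noteq> w\<close> arcs uw no_loop arc_commute[of v u] arc_commute[of w v] arc_commute[of w u]
    by (simp add: y_def matrix_vector_right_distrib matrix_vector_mult_diff_distrib
        inner_diff_left inner_diff_right inner_add_left inner_add_right inner_axis' A_mult_axis)
  finally show False by simp
qed

lemma co_transitive_if_le_zero:
  assumes upper: "\<And>z. z \<in> zero_sum \<Longrightarrow> z \<bullet> (A *v z) \<le> 0"
    and arcs: "(u, v) \<notin> parcs G" "(v, w) \<notin> parcs G"
  shows "(u, w) \<notin> parcs G"
proof
  assume uw: "(u, w) \<in> parcs G"
  define z where "z = (axis u 1 - axis v 1) + (axis w 1 - axis v (1 :: real))"
  have "z \<in> zero_sum"
    unfolding z_def by (intro subspace_add subspace_zero_sum axis_diff_in_zero_sum)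
  then have "z \<bullet> (A *v z) \<le> 0"
    by (rule upper)
  also have "z \<bullet> (A *v z) = 2"
    using arcs uw no_loop arc_commute[of v u] arc_commute[of w v] arc_commute[of w u]
    by (simp only: z_def matrix_vector_right_distrib matrix_vector_mult_diff_distrib
        inner_diff_left inner_diff_right inner_add_left inner_add_right inner_axis' A_mult_axis) simp
  finally show False by simp
qed

lemma exceptional_if_transitive:
  assumes "\<And>u v w. (u, v) \<in> parcs G \<Longrightarrow> (v, w) \<in> parcs G \<Longrightarrow> u \<noteq> w \<Longrightarrow> (u, w) \<in> parcs G"
    and "k > 0"
  shows "\<exists>r. r \<noteq> CARD('v) \<and> is_copies_or_complement G r"
proof -
  obtain r where r: "is_copies_or_complement G r" "CARD('v) = r * Suc k"
    using is_copies_if_transitive assms(1) by blast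
  moreover have "r \<noteq> CARD('v)"
  proof
    assume "r = CARD('v)"
    then have "CARD('v) * 1 = CARD('v) * Suc k"
      using r(2) by simp
    then show False
      using \<open>k > 0\<close> by simp
  qed
  ultimately show ?thesis by blast
qed

text \<open>Apply \<open>exceptional_if_transitive\<close> to the complement, whose degree n - 1 - k
  is positive.\<close>

lemma exceptional_if_co_transitive:
  assumes "\<And>u v w. (u, v) \<notin> parcs G \<Longrightarrow> (v, w) \<notin> parcs G \<Longrightarrow> (u, w) \<notin> parcs G"
    and "Suc k < CARD('v)"
  shows "\<exists>r. r \<noteq> CARD('v) \<and> is_copies_or_complement G r"
proof -
  have "\<exists>r. r \<noteq> CARD('v) \<and> is_copies_or_complement (graph_complement G) r"
    using assms
    by (intro regular_simple_graph.exceptional_if_transitive[OF graph_complement_regular])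
      (auto simp: parcs_graph_complement verts)
  then show ?thesis
    by (simp add: is_copies_or_complement_graph_complement)
qed

text \<open>While \<mu> is the smallest of all eigenvalues, \<nu> is characterised on
  \<open>zero_sum\<close> only: whether it equals \<open>k\<close> depends on connectedness and is
  left open here.\<close>

lemma Rep_not_exceptional:
  assumes n: "2 \<le> CARD('v)"
    and not_exc: "\<not> (\<exists>r. r \<noteq> CARD('v) \<and> is_copies_or_complement G r)"
  obtains \<mu> \<nu> where "\<mu> \<in> eigenvalues A" "\<And>\<theta>. \<theta> \<in> eigenvalues A \<Longrightarrow> \<mu> \<le> \<theta>" "\<mu> \<noteq> k"
    "\<exists>y\<in>zero_sum. y \<noteq> 0 \<and> A *v y = \<nu> *\<^sub>R y"
    "\<And>\<theta> y. y \<in> zero_sum \<Longrightarrow> y \<noteq> 0 \<Longrightarrow> A *v y = \<theta> *\<^sub>R y \<Longrightarrow> \<theta> \<le> \<nu>"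
    "Rep G + Suc (max (eigenvalue_multiplicity A \<mu>) (dim (zero_sum \<inter> eigenspace A \<nu>))) = CARD('v)"
proof -
  \<comment> \<open>The empty graph is the complement of one complete graph, and below, degree n - 1
    means a complete graph; both are exceptional.\<close>
  have k_pos: "k > 0"
  proof (rule ccontr)
    assume "\<not> k > 0"
    then have "(u, v) \<notin> parcs G" for u v
      using degree[of u] by auto
    then show False
      using exceptional_if_co_transitive not_exc n \<open>\<not> k > 0\<close> by auto
  qed
  have k_less: "Suc k < CARD('v)"
  proof (rule ccontr)
    assume k: "\<not> Suc k < CARD('v)"
    have "{v. (u, v) \<in> parcs G} = UNIV - {u}" for u
      using k by (intro card_seteq) (auto simp: degree no_loop)
    then have "(u, v) \<in> parcs G" if "u \<noteq> v" for u v
      using that by blast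
    then show False
      using exceptional_if_transitive k_pos not_exc by blast
  qed
  have nz: "zero_sum \<noteq> ({0} :: (real ^ 'v) set)"
  proof
    assume "zero_sum = ({0} :: (real ^ 'v) set)"
    then have "dim (zero_sum :: (real ^ 'v) set) = 0"
      by (simp only: dim_eq_0)
    then show False
      using dim_zero_sum[where 'v='v] n by linarith
  qed
  obtain \<mu> x where x: "x \<in> zero_sum" "x \<noteq> 0" "A *v x = \<mu> *\<^sub>R x"
    and lower: "\<And>z. z \<in> zero_sum \<Longrightarrow> \<mu> * (z \<bullet> z) \<le> z \<bullet> (A *v z)"
    by (rule self_adjoint_on_min_eigenvector[OF subspace_zero_sum nz A_self_adjoint_on_zero_sum])
      (rule that)
  have "self_adjoint_on zero_sum (\<lambda>z. - (A *v z))"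
    using self_adjoint_on_affine[OF subspace_zero_sum A_self_adjoint_on_zero_sum, of "-1" 0] by simp
  then obtain \<nu>' y where y': "y \<in> zero_sum" "y \<noteq> 0" "- (A *v y) = \<nu>' *\<^sub>R y"
    and upper': "\<And>z. z \<in> zero_sum \<Longrightarrow> \<nu>' * (z \<bullet> z) \<le> z \<bullet> - (A *v z)"
    by (rule self_adjoint_on_min_eigenvector[OF subspace_zero_sum nz]) (rule that)
  define \<nu> where "\<nu> = - \<nu>'"
  have "A *v y = - (- (A *v y))"
    by simp
  then have y: "y \<in> zero_sum" "y \<noteq> 0" "A *v y = \<nu> *\<^sub>R y"
    using y'(1,2) unfolding y'(3) \<nu>_def by simp_all
  have upper: "z \<bullet> (A *v z) \<le> \<nu> * (z \<bullet> z)" if "z \<in> zero_sum" for z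
    using upper'[OF that] by (simp add: \<nu>_def)
  have "\<mu> < -1"
  proof (rule ccontr)
    assume "\<not> \<mu> < -1"
    then have ge: "- (z \<bullet> z) \<le> z \<bullet> (A *v z)" if "z \<in> zero_sum" for z
      using lower[OF that] mult_right_mono[of "-1" \<mu> "z \<bullet> z"] by simp
    have "(u, w) \<in> parcs G" if "(u, v) \<in> parcs G" "(v, w) \<in> parcs G" "u \<noteq> w" for u v w
      using ge by (rule transitive_if_ge_minus_one[OF _ that])
    then show False
      using exceptional_if_transitive k_pos not_exc by blast
  qed
  have "\<nu> > 0"
  proof (rule ccontr)
    assume "\<not> \<nu> > 0"
    then have le: "z \<bullet> (A *v z) \<le> 0" if "z \<in> zero_sum" for z
      using upper[OF that] mult_right_mono[of \<nu> 0 "z \<bullet> z"] by simp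
    have "(u, w) \<notin> parcs G" if "(u, v) \<notin> parcs G" "(v, w) \<notin> parcs G" for u v w
      using le by (rule co_transitive_if_le_zero[OF _ that])
    then show False
      using exceptional_if_co_transitive k_less not_exc by blast
  qed
  have "\<mu> \<noteq> k"
    using \<open>\<mu> < -1\<close> by auto
  have min: "\<mu> \<le> \<theta>" if "\<theta> \<in> eigenvalues A" for \<theta>
  proof (cases "\<theta> = k")
    case True
    then show ?thesis
      using \<open>\<mu> < -1\<close> by simp
  next
    case False
    then obtain z where z: "z \<in> zero_sum" "z \<noteq> 0" "A *v z = \<theta> *\<^sub>R z"
      using \<open>\<theta> \<in> eigenvalues A\<close> eigenspace_subset_zero_sum[of \<theta>]
      by (auto simp: eigenvalues_def eigenspace_def)
    then show ?thesis
      using lower[OF z(1)] by simp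
  qed
  have max: "\<theta> \<le> \<nu>" if "z \<in> zero_sum" "z \<noteq> 0" "A *v z = \<theta> *\<^sub>R z" for \<theta> z
    using upper[OF that(1)] that by simp
  have Int: "zero_sum \<inter> eigenspace A \<mu> = eigenspace A \<mu>"
    using eigenspace_subset_zero_sum[OF \<open>\<mu> \<noteq> k\<close>] by blast
  show ?thesis
  proof (rule that[of \<mu> \<nu>])
    show "\<mu> \<in> eigenvalues A"
      using x by (auto simp: eigenvalues_def)
    show "\<exists>y\<in>zero_sum. y \<noteq> 0 \<and> A *v y = \<nu> *\<^sub>R y"
      using y by blast
    show "Rep G + Suc (max (eigenvalue_multiplicity A \<mu>)
        (dim (zero_sum \<inter> eigenspace A \<nu>))) = CARD('v)"
      using Rep_extreme_eigenvalues[OF x \<open>\<mu> < -1\<close> lower y \<open>\<nu> > 0\<close> upper]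
      by (simp add: eigenvalue_multiplicity_def Int)
  qed (fact min, fact \<open>\<mu> \<noteq> k\<close>, fact max)
qed

end

section \<open>Matching the extreme eigenvalues with the ordered list\<close>

theorem theorem3p2:
  fixes G :: "'v::finite pair_pre_digraph" and n :: nat
  assumes "pair_graph G" and "pverts G = UNIV"
    and "n = CARD('v)" and "n \<ge> 2"
    and "regular_graph G"
  shows
    "(\<forall>r. r \<noteq> n \<and> is_copies_or_complement G r \<longrightarrow> int (Rep G) = int n - int r) \<and>
     (\<not> (\<exists>r. r \<noteq> n \<and> is_copies_or_complement G r) \<longrightarrow>
       (\<forall>(s :: nat) (\<tau> :: nat \<Rightarrow> real) (m :: nat \<Rightarrow> nat).
         strict_mono_on {1..s} \<tau> \<and>
         \<tau> ` {1..s} = eigenvalues (adjacency_matrix G) \<and>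
         (\<forall>i\<in>{1..s}. m i = eigenvalue_multiplicity (adjacency_matrix G) (\<tau> i)) \<longrightarrow>
         (Digraph_Component.connected (with_proj G) \<longrightarrow>
           int (Rep G) = int n - 1 - int (max (m 1) (m (s - 1)))) \<and>
         (\<forall>r. \<not> Digraph_Component.connected (with_proj G) \<and>
           r = card (pre_digraph.sccs_verts (with_proj G)) \<longrightarrow>
           int (Rep G) = int n - 1 - max (int (m 1)) (int r - 1))))"
proof -
  obtain k where k: "\<And>v. out_degree (with_proj G) v = k"
    using assms(2,5) by (auto simp: regular_graph_def)
  interpret G: pair_graph G
    by (rule assms(1))
  interpret regular_simple_graph G k
  proof
    show "(v, u) \<in> parcs G" if "(u, v) \<in> parcs G" for u v
      using that G.pair_sym_arcs by (auto simp: symmetric_def sym_def)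
    show "(u, u) \<notin> parcs G" for u
      using G.pair_no_loops by fastforce
    show "card {v. (u, v) \<in> parcs G} = k" for u
    proof -
      have "out_arcs (with_proj G) u = Pair u ` {v. (u, v) \<in> parcs G}"
        by (auto simp: out_arcs_def)
      then show ?thesis
        using k[of u] by (simp add: out_degree_def card_image inj_on_def)
    qed
  qed (rule assms(2))
  show ?thesis
  proof (intro conjI allI impI; (elim conjE)?)
    fix r assume "r \<noteq> n" "is_copies_or_complement G r"
    then have "Rep G + r = n"
      using Rep_copies_or_complement assms(3) by simp
    then show "int (Rep G) = int n - int r"
      by linarith
  next
    fix s :: nat and \<tau> :: "nat \<Rightarrow> real" and m :: "nat \<Rightarrow> nat"
    assume "\<not> (\<exists>r. r \<noteq> n \<and> is_copies_or_complement G r)"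
      and mono: "strict_mono_on {1..s} \<tau>" and img: "\<tau> ` {1..s} = eigenvalues A"
      and m: "\<forall>i\<in>{1..s}. m i = eigenvalue_multiplicity A (\<tau> i)"
    then obtain \<mu> \<nu> where \<mu>: "\<mu> \<in> eigenvalues A" "\<And>\<theta>. \<theta> \<in> eigenvalues A \<Longrightarrow> \<mu> \<le> \<theta>" "\<mu> \<noteq> k"
      and \<nu>: "\<exists>y\<in>zero_sum. y \<noteq> 0 \<and> A *v y = \<nu> *\<^sub>R y"
        "\<And>\<theta> y. y \<in> zero_sum \<Longrightarrow> y \<noteq> 0 \<Longrightarrow> A *v y = \<theta> *\<^sub>R y \<Longrightarrow> \<theta> \<le> \<nu>"
      and Rep: "Rep G + Suc (max (eigenvalue_multiplicity A \<mu>) (dim (zero_sum \<inter> eigenspace A \<nu>))) = n"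
      using Rep_not_exceptional assms(3,4) by blast
    have less_iff: "\<tau> i < \<tau> j \<longleftrightarrow> i < j" if "i \<in> {1..s}" "j \<in> {1..s}" for i j
      using strict_mono_on_less[OF mono] that by blast
    have \<tau>_in: "\<tau> i \<in> eigenvalues A" if "i \<in> {1..s}" for i
      using img that by blast
    obtain i where i: "i \<in> {1..s}" "\<tau> i = \<mu>"
      using img \<mu>(1) by (metis imageE)
    have "\<tau> 1 = \<mu>"
      using less_iff[of 1 i] \<mu>(2)[OF \<tau>_in, of 1] i by (cases "i = 1") force+
    then have m1: "m 1 = eigenvalue_multiplicity A \<mu>"
      using m i(1) by simp
    have le_k: "\<theta> \<le> k" if "\<theta> \<in> eigenvalues A" for \<theta>
    proof -
      obtain x where "x \<noteq> 0" "A *v x = \<theta> *\<^sub>R x"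
        using \<open>\<theta> \<in> eigenvalues A\<close> by (auto simp: eigenvalues_def)
      then show ?thesis
        using A_le_degree[of x] by simp
    qed
    have "1 \<in> eigenspace A k"
      by (simp add: eigenspace_def A_mult_one)
    then have k_in: "real k \<in> eigenvalues A"
      unfolding eigenvalues_iff by (intro bexI[of _ 1]) (auto simp: vec_eq_iff)
    have \<nu>_in: "\<nu> \<in> eigenvalues A"
      using \<nu>(1) by (auto simp: eigenvalues_def)
    note card = dim_zero_sum_Int_eigenspace_degree
    {
      assume "Digraph_Component.connected (with_proj G)"
      \<comment> \<open>With one component the eigenspace of \<open>k\<close> meets
        \<open>zero_sum\<close> trivially, so \<nu> lies strictly below \<open>k\<close>.\<close>
      then have "zero_sum \<inter> eigenspace A k \<subseteq> {0}"
        using card by (simp add: connected_iff_card_sccs_verts)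
      then have "\<nu> \<noteq> k"
        using \<nu>(1) by (auto simp: eigenspace_def)
      then have "dim (zero_sum \<inter> eigenspace A \<nu>) = eigenvalue_multiplicity A \<nu>"
        using eigenspace_subset_zero_sum[of \<nu>]
        by (simp add: eigenvalue_multiplicity_def Int_absorb1)
      moreover have "m (s - 1) = eigenvalue_multiplicity A \<nu>"
      proof -
        obtain j where j: "j \<in> {1..s}" "\<tau> j = \<nu>"
          using img \<nu>_in by (metis imageE)
        obtain l where l: "l \<in> {1..s}" "\<tau> l = k"
          using img k_in by (metis imageE)
        have "\<nu> < k"
          using le_k[OF \<nu>_in] \<open>\<nu> \<noteq> k\<close> by simp
        then have "j < l"
          using less_iff[of j l] j l by simp
        \<comment> \<open>Two distinct eigenvalues \<nu> < k force \<open>s\<close> to be at least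
          2, so \<open>s - 1\<close> is a genuine index. As \<tau> (s - 1) < k, its eigenvectors are
          zero-sum, and maximality of \<nu> leaves no index strictly between \<open>j\<close> and
          \<open>s\<close>.\<close>
        then have s: "s - 1 \<in> {1..s}" "s \<in> {1..s}" "s - 1 < s" "j \<le> s - 1"
          using j l by auto
        then have "\<tau> (s - 1) < k"
          using less_iff[OF s(1,2)] le_k[OF \<tau>_in[OF s(2)]] by simp
        then obtain z where "z \<in> zero_sum" "z \<noteq> 0" "A *v z = \<tau> (s - 1) *\<^sub>R z"
          using \<tau>_in[OF s(1)] eigenspace_subset_zero_sum[of "\<tau> (s - 1)"]
          by (auto simp: eigenvalues_def eigenspace_def)
        then have "\<tau> (s - 1) \<le> \<tau> j"
          using \<nu>(2) j(2) by simp
        then have "j = s - 1"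
          using less_iff[OF j(1) s(1)] s(4) by linarith
        then show ?thesis
          using m s(1) j(2) by simp
      qed
      ultimately show "int (Rep G) = int n - 1 - int (max (m 1) (m (s - 1)))"
        using Rep m1 by simp
    next
      fix r assume disconn: "\<not> Digraph_Component.connected (with_proj G)"
        and r: "r = card (pre_digraph.sccs_verts (with_proj G))"
      have "r \<noteq> 1"
        using disconn r by (simp add: connected_iff_card_sccs_verts)
      \<comment> \<open>The dimension here is r - 1 > 0, so \<open>k\<close> itself is an eigenvalue
        on \<open>zero_sum\<close> and \<nu> equals it.\<close>
      then have "\<not> zero_sum \<inter> eigenspace A k \<subseteq> {0}"
        using card r by (simp flip: dim_eq_0)
      then have "k \<le> \<nu>"
        using \<nu>(2) by (auto simp: eigenspace_def)
      then have "\<nu> = k"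
        using le_k[OF \<nu>_in] by simp
      then show "int (Rep G) = int n - 1 - max (int (m 1)) (int r - 1)"
        using Rep m1 card r by simp
    }
  qed
qed

end
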